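(* Let $r\ge 2$, let $F$ be an $r$-graph with $V(F)=\{1,\dots,f\}$, at least one edge and no isolated vertices, let $(H,\sigma)$ be an $F$-coloured finite $r$-graph with no isolated vertices, and write $h=v(H)$, $m=e(H)$. Let $\theta_1,\dots,\theta_f$ be pairwise distinct integers, let $D=D_{H,\sigma,\theta}:\mathbb Q^{V(H)}\to\mathbb Q^{E(H)}$ be the linear map $$(Dy)_e=\sum_{u\in e}\frac{y_u}{\prod_{v\in e\setminus\{u\}}(\theta_{\sigma(u)}-\theta_{\sigma(v)})}\qquad(e\in E(H)),$$ let $\mathcal S=\operatorname{im}_{\mathbb Q}(D)$, $s=\dim_{\mathbb Q}\mathcal S$, and let $B\in\mathbb Z^{(m-s)\times m}$ be a fixed full-row-rank matrix (columns indexed by $E(H)$) with $\ker_{\mathbb Q}(B)=\mathcal S$. Assume that there are constants $c,C>0$ such that, for every $0<\varepsilon\le1$, every sufficiently large (in terms of $\varepsilon$) uniformly $\varepsilon$-far $F$-partite $r$-graph $G$ satisfies $\mathrm{Emb}_\sigma(H,G)\ge c\varepsilon^C v(G)^h$. Then there is a constant $c_0>0$ such that, for every $\delta>0$, the following statements hold. (i) There is $p_0=p_0(\delta)$ such that, for every prime $p\ge p_0$ and every $A\subseteq\mathbb F_p$ with $|A|\ge\delta p$, $$|\ker(B\bmod p)\cap A^m|\ge c_0\delta^Cp^s.$$ (ii) There is $N_0=N_0(\delta)$ such that, for every $N\ge N_0$ and every $A\subseteq\{1,\dots,N\}$ with $|A|\ge\delta N$, $$|\{x\in A^m: Bx=0\text{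 over }\mathbb Z\}|\ge c_0\delta^CN^s.$$ If $m\ge2$, both statements remain valid when only proper solutions are counted. Moreover, $B\mathbf 1=0$.
   Context: An $r$-graph is a finite simple $r$-uniform hypergraph $H$; $v(H)$ and $e(H)$ are its numbers of vertices and edges. A vertex is isolated if it lies in no edge. A homomorphism $H\to G$ is a map $\phi:V(H)\to V(G)$ with $\phi(e)\in E(G)$ for every $e\in E(H)$; an embedding is an injective homomorphism. An $F$-colouring of $G$ is a homomorphism $\kappa_G:G\to F$; an $r$-graph with a fixed $F$-colouring (equivalently, with the partition into the sets $\kappa_G^{-1}(a)$, $a\in V(F)$) is $F$-partite. An $F$-coloured $r$-graph is a pair $(H,\sigma)$ with $\sigma:H\to F$ an $F$-colouring. For $G$ $F$-partite, $\mathrm{Emb}_\sigma(H,G)$ is the number of embeddings $\phi:H\to G$ with $\kappa_G\circ\phi=\sigma$. An $n$-vertex $F$-partite $r$-graph $G$ is uniformly $\varepsilon$-far (from being $F$-free) if there is a collection $\mathcal C$ of embeddings $\psi:F\to G$ such that the sets $\psi(E(F))$, $\psi\in\mathcal C$, are pairwise disjoint, $\kappa_G\circ\psi=\mathrm{id}_{V(F)}$ for every $\psi\in\mathcal C$, and every vertex of $G$ belongs to $\psi(V(F))$ for at least $\varepsilon n^{r-1}$ members $\psi\in\mathcal C$. $B\bmod p$ is the matrix obtained by reducing every entry of $B$ modulo $p$. When $s=m$, $B$ is the matrix with zero rows and $m$ columns. $\mathbf 1$ is the all-one vector. A solution $x=(x_1,\dots,x_m)$ is proper if its coordinates are pairwise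 distinct. *)

theory Defs
  imports
    Complex_Main
    "HOL-Library.FuncSet"
    "HOL-Library.Disjoint_Sets"
    "HOL-Library.Function_Algebras"
    "HOL-Computational_Algebra.Primes"
    "HOL-Number_Theory.Cong"
begin

record 'a hgraph =
  verts :: "'a set"
  edges :: "'a set set"

definition r_graph :: "nat \<Rightarrow> 'a hgraph \<Rightarrow> bool" where
  "r_graph r G \<longleftrightarrow> finite (verts G) \<and> (\<forall>e\<in>edges G. e \<subseteq> verts G \<and> card e = r)"

definition no_isolated_vertices :: "'a hgraph \<Rightarrow> bool" where
  "no_isolated_vertices G \<longleftrightarrow> (\<forall>v\<in>verts G. \<exists>e\<in>edges G. v \<in> e)"

text \<open>Only the values on the vertices of the source matter for a homomorphism; an \<open>F\<close>-colouring
  of \<open>G\<close> is a map \<open>\<kappa>\<close> with \<open>homomorphism \<kappa> G F\<close>.\<close>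

definition homomorphism :: "('a \<Rightarrow> 'b) \<Rightarrow> 'a hgraph \<Rightarrow> 'b hgraph \<Rightarrow> bool" where
  "homomorphism \<phi> H G \<longleftrightarrow> \<phi> \<in> verts H \<rightarrow> verts G \<and> (\<forall>e\<in>edges H. \<phi> ` e \<in> edges G)"

text \<open>Embeddings are taken extensional, i.e. with a fixed value outside the vertex set, so that they
  can be counted.\<close>

definition embeddings :: "'a hgraph \<Rightarrow> 'b hgraph \<Rightarrow> ('a \<Rightarrow> 'b) set" where
  "embeddings H G =
     {\<phi> \<in> extensional (verts H). homomorphism \<phi> H G \<and> inj_on \<phi> (verts H)}"

definition Emb :: "'a hgraph \<Rightarrow> ('a \<Rightarrow> 'c) \<Rightarrow> 'b hgraph \<Rightarrow> ('b \<Rightarrow> 'c) \<Rightarrow> nat" where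
  "Emb H \<sigma> G \<kappa> = card {\<phi> \<in> embeddings H G. \<forall>v\<in>verts H. \<kappa> (\<phi> v) = \<sigma> v}"

definition uniformly_far ::
    "nat \<Rightarrow> 'c hgraph \<Rightarrow> real \<Rightarrow> 'b hgraph \<Rightarrow> ('b \<Rightarrow> 'c) \<Rightarrow> bool" where
  "uniformly_far r F \<epsilon> G \<kappa> \<longleftrightarrow>
     (\<exists>\<C> \<subseteq> embeddings F G.
        disjoint_family_on (\<lambda>\<psi>. (`) \<psi> ` edges F) \<C> \<and>
        (\<forall>\<psi>\<in>\<C>. \<forall>a\<in>verts F. \<kappa> (\<psi> a) = a) \<and>
        (\<forall>v\<in>verts G.
           real (card {\<psi>\<in>\<C>. v \<in> \<psi> ` verts F}) \<ge> \<epsilon> * real (card (verts G)) ^ (r - 1)))"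

text \<open>The space \<open>\<rat>\<^sup>I\<close> is realised as the functions \<open>'i \<Rightarrow> rat\<close> vanishing outside \<open>I\<close>.\<close>

interpretation ratfun: vector_space "\<lambda>(c::rat) (x :: 'i \<Rightarrow> rat) i. c * x i"
  by unfold_locales (auto simp: fun_eq_iff algebra_simps)

definition rat_space :: "'i set \<Rightarrow> ('i \<Rightarrow> rat) set" where
  "rat_space I = {x. \<forall>i. i \<notin> I \<longrightarrow> x i = 0}"

definition Dmap ::
    "'a hgraph \<Rightarrow> ('a \<Rightarrow> 'c) \<Rightarrow> ('c \<Rightarrow> int) \<Rightarrow> ('a \<Rightarrow> rat) \<Rightarrow> 'a set \<Rightarrow> rat" where
  "Dmap H \<sigma> \<theta> y = (\<lambda>e. if e \<in> edges H
     then \<Sum>u\<in>e. y u / (\<Prod>v\<in>e - {u}. of_int (\<theta> (\<sigma> u)) - of_int (\<theta> (\<sigma> v)))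
     else 0)"

definition Dimage :: "'a hgraph \<Rightarrow> ('a \<Rightarrow> 'c) \<Rightarrow> ('c \<Rightarrow> int) \<Rightarrow> ('a set \<Rightarrow> rat) set" where
  "Dimage H \<sigma> \<theta> = Dmap H \<sigma> \<theta> ` rat_space (verts H)"

text \<open>An integer matrix with \<open>k\<close> rows and columns indexed by a finite set \<open>I\<close> is a function
  \<open>B :: nat \<Rightarrow> 'i \<Rightarrow> int\<close>, of which only the entries \<open>B j i\<close> with \<open>j < k\<close> and \<open>i \<in> I\<close> are used.\<close>

definition mat_vec :: "'i set \<Rightarrow> (nat \<Rightarrow> 'i \<Rightarrow> 'b::comm_ring_1) \<Rightarrow> ('i \<Rightarrow> 'b) \<Rightarrow> nat \<Rightarrow> 'b" where
  "mat_vec I B x j = (\<Sum>i\<in>I. B j i * x i)"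

definition rat_row :: "'i set \<Rightarrow> (nat \<Rightarrow> 'i \<Rightarrow> int) \<Rightarrow> nat \<Rightarrow> 'i \<Rightarrow> rat" where
  "rat_row I B j = (\<lambda>i. if i \<in> I then of_int (B j i) else 0)"

definition full_row_rank :: "nat \<Rightarrow> 'i set \<Rightarrow> (nat \<Rightarrow> 'i \<Rightarrow> int) \<Rightarrow> bool" where
  "full_row_rank k I B \<longleftrightarrow> ratfun.dim (rat_row I B ` {..<k}) = k"

definition ker_rat :: "nat \<Rightarrow> 'i set \<Rightarrow> (nat \<Rightarrow> 'i \<Rightarrow> int) \<Rightarrow> ('i \<Rightarrow> rat) set" where
  "ker_rat k I B =
     {x \<in> rat_space I. \<forall>j<k. mat_vec I (\<lambda>j i. of_int (B j i)) x j = 0}"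

text \<open>The field \<open>\<bbbF>\<^sub>p\<close> is represented by the residues \<open>{0..<p}\<close> with arithmetic modulo \<open>p\<close>.\<close>

definition mat_mod :: "(nat \<Rightarrow> 'i \<Rightarrow> int) \<Rightarrow> nat \<Rightarrow> nat \<Rightarrow> 'i \<Rightarrow> int" where
  "mat_mod B p = (\<lambda>j i. B j i mod int p)"

definition ker_mod :: "nat \<Rightarrow> nat \<Rightarrow> 'i set \<Rightarrow> (nat \<Rightarrow> 'i \<Rightarrow> int) \<Rightarrow> ('i \<Rightarrow> int) set" where
  "ker_mod p k I M =
     {x \<in> I \<rightarrow>\<^sub>E {0..<int p}. \<forall>j<k. [mat_vec I M x j = 0] (mod int p)}"

definition int_solutions ::
    "nat \<Rightarrow> 'i set \<Rightarrow> (nat \<Rightarrow> 'i \<Rightarrow> int) \<Rightarrow> int set \<Rightarrow> ('i \<Rightarrow> int) set" where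
  "int_solutions k I B A = {x \<in> I \<rightarrow>\<^sub>E A. \<forall>j<k. mat_vec I B x j = 0}"

definition proper :: "'i set \<Rightarrow> ('i \<Rightarrow> int) \<Rightarrow> bool" where
  "proper I x \<longleftrightarrow> inj_on x I"

end

theory Submission
  imports Defs "HOL-Computational_Algebra.Polynomial"
begin

text \<open>
  The linear form attached to an edge \<open>e\<close> of \<open>H\<close> is the divided difference of the values \<open>y\<close> at the
  \<open>r\<close> nodes \<open>\<theta>(\<sigma>(u))\<close>, and it reads off the coefficient of \<open>x\<^sup>r\<^sup>-\<^sup>1\<close> if \<open>y\<close> consists of the
  values of a polynomial of degree below \<open>r\<close>. After multiplication by \<open>M = \<Prod>(\<theta>\<^sub>a - \<theta>\<^sub>b)\<close> it has
  integer coefficients.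

  Given a set \<open>A\<close> of residues modulo \<open>n\<close>, join residues \<open>y\<^sub>a\<close>, for \<open>a\<close> in an edge of \<open>F\<close>, by an edge if their scaled
  divided difference lies in \<open>A\<close>. A polynomial of degree below \<open>r\<close> whose leading coefficient,
  scaled by \<open>M\<close>, lies in \<open>A\<close> traces out a copy of \<open>F\<close>. Since \<open>r\<close> values determine the polynomial, these copies are
  edge-disjoint, and \<open>|A| n\<^sup>r\<^sup>-\<^sup>2\<close> of them pass through each vertex. So the graph is
  uniformly far (\<open>residue_graph_uniformly_far\<close>), and the hypothesis yields many embeddings of \<open>H\<close>, that
  is, many labellings \<open>y\<close> of the vertices of \<open>H\<close> with \<open>M D y \<in> A\<^sup>m\<close>. As \<open>B D = 0\<close>, every \<open>M D y\<close> solves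
  the system modulo \<open>n\<close>. A left inverse of \<open>D\<close> on \<open>s\<close> suitable coordinates, with denominators cleared,
  shows that each solution arises from at most \<open>n\<^sup>h\<^sup>-\<^sup>s\<close> labellings
  (\<open>labellings_le_solutions\<close>), which leaves a positive proportion of \<open>n\<^sup>s\<close> solutions. Labellings for which two
  coordinates of \<open>M D y\<close> coincide satisfy one of at most \<open>m\<^sup>2\<close> nontrivial linear equations, so there
  are only \<open>O(n\<^sup>h\<^sup>-\<^sup>1)\<close> of them (\<open>good_le_proper_labellings\<close>); hence the solutions may be taken proper.

  The argument inverts only a fixed finite set of integers, so that it works for every modulus \<open>n\<close> coprime to a
  constant \<open>W\<close>. Large primes give the first assertion. For subsets of \<open>{1..N}\<close> take \<open>n = W b N + 1\<close>, where \<open>b\<close>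
  bounds the row sums of \<open>\<bar>B\<bar>\<close>: solutions modulo \<open>n\<close> with entries in \<open>{1..N}\<close> are then solutions over the integers
  (\<open>modular_solutions_are_integral\<close>).
\<close>

section \<open>Divided differences with cleared denominators\<close>

text \<open>The sum is the top coefficient of the polynomial of degree below \<open>card e\<close> that interpolates
  \<open>x\<^sup>k\<close> at the nodes, written in Lagrange's form. Interpolation reproduces \<open>x\<^sup>k\<close> itself, whose
  coefficient there is \<open>1\<close> or \<open>0\<close>.\<close>

lemma lagrange_leading_coefficient:
  fixes t :: "'a \<Rightarrow> 'b::field"
  assumes fin: "finite e" and inj: "inj_on t e" and k: "k < card e"
  shows "(\<Sum>u\<in>e. t u ^ k / (\<Prod>v\<in>e - {u}. t u - t v)) = (if k = card e - 1 then 1 else 0)"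
proof -
  define q where "q u = (\<Prod>v\<in>e - {u}. [:- t v, 1:])" for u
  define w where "w u = (\<Prod>v\<in>e - {u}. t u - t v)" for u
  define P where "P = (\<Sum>u\<in>e. smult (t u ^ k / w u) (q u))"
  have w0: "w u \<noteq> 0" if "u \<in> e" for u
    using that inj fin by (auto simp: w_def inj_on_def)
  have deg_q: "degree (q u) = card e - 1" if "u \<in> e" for u
    using that fin by (simp add: q_def degree_prod_eq_sum_degree)
  have monic: "coeff (q u) (card e - 1) = 1" if "u \<in> e" for u
    using lead_coeff_prod[of "\<lambda>v. [:- t v, 1:]" "e - {u}"] deg_q[OF that] by (simp add: q_def)
  have deg_P: "degree P \<le> card e - 1"
    unfolding P_def by (rule degree_sum_le[OF fin])
      (metis deg_q degree_smult_le)
  have poly_P: "poly P (t x) = t x ^ k" if "x \<in> e" for x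
  proof -
    have "poly (q u) (t x) = 0" if "u \<in> e - {x}" for u
      using that \<open>x \<in> e\<close> fin by (auto simp: q_def poly_prod)
    hence "poly P (t x) = t x ^ k / w x * poly (q x) (t x)"
      using fin \<open>x \<in> e\<close> by (simp add: P_def poly_sum sum.remove)
    also have "poly (q x) (t x) = w x"
      by (simp add: q_def w_def poly_prod)
    finally show ?thesis using w0[OF that] by simp
  qed
  have "P = monom 1 k"
  proof (rule poly_eqI_degree[where A = "t ` e"])
    show "poly P x = poly (monom 1 k) x" if "x \<in> t ` e" for x
      using that poly_P by (auto simp: poly_monom)
    show "degree P < card (t ` e)" "degree (monom (1::'b) k) < card (t ` e)"
      using deg_P k by (auto simp: card_image[OF inj] degree_monom_eq)
  qed
  moreover have "coeff P (card e - 1) = (\<Sum>u\<in>e. t u ^ k / w u)"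
    by (simp add: P_def coeff_sum monic[simplified])
  ultimately show ?thesis by (auto simp: w_def)
qed

text \<open>Such an \<open>M\<close> is a common denominator: the divided difference over \<open>e\<close> becomes an integral linear form after
  multiplication by \<open>M\<close>, and all its coefficients are units modulo every \<open>n\<close> coprime to \<open>M\<close>.\<close>

definition nodes_divide :: "('a \<Rightarrow> int) \<Rightarrow> int \<Rightarrow> 'a set \<Rightarrow> bool" where
  "nodes_divide t M e \<longleftrightarrow> finite e \<and> inj_on t e \<and> (\<forall>u\<in>e. (\<Prod>v\<in>e - {u}. t u - t v) dvd M)"

definition dd_weight :: "('a \<Rightarrow> int) \<Rightarrow> int \<Rightarrow> 'a set \<Rightarrow> 'a \<Rightarrow> int" where
  "dd_weight t M e u = M div (\<Prod>v\<in>e - {u}. t u - t v)"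

text \<open>\<open>M\<close> times the divided difference of the values \<open>y\<close> at the nodes \<open>t\<close>: an integral version of one
  coordinate of \<^term>\<open>Dmap\<close>.\<close>

definition scaled_dd :: "('a \<Rightarrow> int) \<Rightarrow> int \<Rightarrow> ('a \<Rightarrow> int) \<Rightarrow> 'a set \<Rightarrow> int" where
  "scaled_dd t M y e = (\<Sum>u\<in>e. dd_weight t M e u * y u)"

definition power_poly :: "nat \<Rightarrow> (nat \<Rightarrow> int) \<Rightarrow> int \<Rightarrow> int" where
  "power_poly k c x = (\<Sum>i<k. c i * x ^ i)"

lemma nodes_divide_subset:
  assumes "nodes_divide t M e" "d \<subseteq> e"
  shows "nodes_divide t M d"
  unfolding nodes_divide_def
proof (intro conjI ballI)
  fix u assume "u \<in> d"
  have "(\<Prod>v\<in>d - {u}. t u - t v) dvd (\<Prod>v\<in>e - {u}. t u - t v)"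
    using assms by (intro prod_dvd_prod_subset) (auto simp: nodes_divide_def)
  thus "(\<Prod>v\<in>d - {u}. t u - t v) dvd M"
    using assms \<open>u \<in> d\<close> by (auto simp: nodes_divide_def intro: dvd_trans)
qed (use assms in \<open>auto simp: nodes_divide_def intro: finite_subset inj_on_subset\<close>)

lemma dd_weight_dvd: "nodes_divide t M e \<Longrightarrow> u \<in> e \<Longrightarrow> dd_weight t M e u dvd M"
  unfolding nodes_divide_def dd_weight_def by (metis dvd_div_mult_self dvd_triv_left)

lemma of_int_weight:
  assumes "nodes_divide t M e" "u \<in> e"
  shows "of_int (dd_weight t M e u) = (of_int M / (\<Prod>v\<in>e - {u}. of_int (t u) - of_int (t v)) :: rat)"
proof -
  let ?w = "\<Prod>v\<in>e - {u}. t u - t v"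
  have "?w dvd M" and w0: "?w \<noteq> 0"
    using assms by (auto simp: nodes_divide_def inj_on_def)
  hence "dd_weight t M e u * ?w = M" by (simp add: dd_weight_def)
  hence "rat_of_int (dd_weight t M e u) * of_int ?w = of_int M" by (metis of_int_mult)
  moreover have "rat_of_int ?w \<noteq> 0" using w0 by (simp only: of_int_eq_0_iff not_False_eq_True)
  ultimately have "rat_of_int (dd_weight t M e u) = of_int M / of_int ?w"
    by (metis nonzero_mult_div_cancel_right)
  thus ?thesis by simp
qed

text \<open>A divided difference of order \<open>k\<close> annihilates lower powers and reads off the coefficient of
  \<open>x\<^sup>k\<close>, whatever the \<open>k + 1\<close> distinct nodes are. This is the reason why one polynomial gives the same value on
  all edges of the pattern at once.\<close>

lemma scaled_dd_power_poly:
  assumes nd: "nodes_divide t M e" and k: "card e = Suc k"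
  shows "scaled_dd t M (\<lambda>u. power_poly (Suc k) c (t u)) e = M * c k"
proof -
  let ?w = "\<lambda>u. \<Prod>v\<in>e - {u}. rat_of_int (t u) - rat_of_int (t v)"
  have inj: "inj_on (\<lambda>u. rat_of_int (t u)) e" and fin: "finite e"
    using nd by (auto simp: nodes_divide_def inj_on_def)
  have "rat_of_int (scaled_dd t M (\<lambda>u. power_poly (Suc k) c (t u)) e)
      = (\<Sum>u\<in>e. of_int M / ?w u * (\<Sum>i<Suc k. of_int (c i) * of_int (t u) ^ i))"
    by (simp add: scaled_dd_def power_poly_def of_int_weight[OF nd] del: sum.lessThan_Suc)
  also have "\<dots> = (\<Sum>u\<in>e. \<Sum>i<Suc k. of_int M * of_int (c i) * (of_int (t u) ^ i / ?w u))"
    unfolding sum_distrib_left by (intro sum.cong refl) simp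
  also have "\<dots> = (\<Sum>i<Suc k. of_int M * of_int (c i) * (\<Sum>u\<in>e. of_int (t u) ^ i / ?w u))"
    unfolding sum_distrib_left by (rule sum.swap)
  also have "\<dots> = (\<Sum>i<Suc k. if i = k then of_int M * of_int (c i) else 0)"
    by (intro sum.cong refl) (simp add: lagrange_leading_coefficient[OF fin inj] k)
  also have "\<dots> = rat_of_int (M * c k)" by simp
  finally show ?thesis by (simp only: of_int_eq_iff)
qed

lemma scaled_dd_cong_mod:
  assumes "\<And>u. u \<in> e \<Longrightarrow> [y u = z u] (mod n)"
  shows "[scaled_dd t M y e = scaled_dd t M z e] (mod n)"
  unfolding scaled_dd_def using assms by (intro cong_sum cong_mult cong_refl)

text \<open>The divided difference over all \<open>k\<close> nodes isolates the top coefficient; once that vanishes, the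
  remaining polynomial has one coefficient less and still vanishes at \<open>k - 1\<close> of the nodes. Each step
  divides by \<open>M\<close>, a unit modulo \<open>n\<close>.\<close>

lemma power_poly_coeffs_vanish:
  assumes "nodes_divide t M e" "card e = k" "coprime M n"
    and "\<And>u. u \<in> e \<Longrightarrow> [power_poly k d (t u) = 0] (mod n)" "i < k"
  shows "[d i = 0] (mod n)"
  using assms
proof (induction k arbitrary: e)
  case (Suc k)
  have "[scaled_dd t M (\<lambda>u. power_poly (Suc k) d (t u)) e = scaled_dd t M (\<lambda>_. 0) e] (mod n)"
    by (rule scaled_dd_cong_mod) (use Suc.prems in auto)
  hence "[M * d k = M * 0] (mod n)"
    using Suc.prems by (simp add: scaled_dd_power_poly) (simp add: scaled_dd_def)
  hence top: "[d k = 0] (mod n)"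
    using Suc.prems(3) cong_mult_lcancel by blast
  obtain x where x: "x \<in> e" using Suc.prems(2) by fastforce
  show ?case
  proof (cases "i = k")
    case False
    show ?thesis
    proof (rule Suc.IH[of "e - {x}"])
      show "nodes_divide t M (e - {x})" using Suc.prems(1) by (rule nodes_divide_subset) auto
      show "card (e - {x}) = k" using x Suc.prems(2) by simp
      fix u assume "u \<in> e - {x}"
      hence "[power_poly k d (t u) + d k * t u ^ k = 0] (mod n)"
        using Suc.prems(4)[of u] by (simp add: power_poly_def)
      moreover have "[d k * t u ^ k = 0] (mod n)"
        using cong_mult[OF top cong_refl, of "t u ^ k"] by simp
      ultimately show "[power_poly k d (t u) = 0] (mod n)"
        by (metis add.right_neutral cong_add_lcancel cong_sym cong_trans)
    qed (use Suc.prems False in auto)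
  qed (use top in simp)
qed simp

lemma power_poly_determined:
  assumes "nodes_divide t M e" "card e = k" "coprime M n"
    and "\<And>u. u \<in> e \<Longrightarrow> [power_poly k c (t u) = power_poly k d (t u)] (mod n)" "i < k"
  shows "[c i = d i] (mod n)"
proof -
  have "[c i - d i = 0] (mod n)"
  proof (rule power_poly_coeffs_vanish[OF assms(1-3) _ assms(5)])
    fix u assume "u \<in> e"
    show "[power_poly k (\<lambda>i. c i - d i) (t u) = 0] (mod n)"
      using assms(4)[OF \<open>u \<in> e\<close>]
      by (simp add: power_poly_def left_diff_distrib sum_subtractf cong_diff_iff_cong_0)
  qed
  thus ?thesis by (simp add: cong_diff_iff_cong_0)
qed

definition node_product :: "'c set \<Rightarrow> ('c \<Rightarrow> int) \<Rightarrow> int" where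
  "node_product T \<theta> = (\<Prod>a\<in>T. \<Prod>b\<in>T - {a}. \<theta> a - \<theta> b)"

lemma node_product_nonzero: "finite T \<Longrightarrow> inj_on \<theta> T \<Longrightarrow> node_product T \<theta> \<noteq> 0"
  by (auto simp: node_product_def inj_on_def)

text \<open>A single \<open>M\<close> serves all edges of all graphs coloured by \<open>T\<close>, because the colouring is injective on
  every edge.\<close>

lemma node_product_divisible:
  assumes "finite T" "inj_on \<theta> T" "finite e" "inj_on \<sigma> e" "\<sigma> ` e \<subseteq> T"
  shows "nodes_divide (\<lambda>v. \<theta> (\<sigma> v)) (node_product T \<theta>) e"
  unfolding nodes_divide_def
proof (intro conjI ballI)
  show "inj_on (\<lambda>v. \<theta> (\<sigma> v)) e"
    using assms by (auto simp: inj_on_def subset_iff)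
  fix u assume u: "u \<in> e"
  have "(\<Prod>v\<in>e - {u}. \<theta> (\<sigma> u) - \<theta> (\<sigma> v)) = (\<Prod>b\<in>\<sigma> ` (e - {u}). \<theta> (\<sigma> u) - \<theta> b)"
    using assms(4) by (subst prod.reindex) (auto simp: inj_on_def)
  also have "\<dots> dvd (\<Prod>b\<in>T - {\<sigma> u}. \<theta> (\<sigma> u) - \<theta> b)"
    using assms u by (intro prod_dvd_prod_subset) (auto simp: inj_on_def)
  also have "\<dots> dvd node_product T \<theta>"
    unfolding node_product_def using assms u by (intro dvd_prodI) auto
  finally show "(\<Prod>v\<in>e - {u}. \<theta> (\<sigma> u) - \<theta> (\<sigma> v)) dvd node_product T \<theta>" .
qed (use assms in auto)

lemma scaled_dd_cong:
  assumes "\<And>u. u \<in> e \<Longrightarrow> t u = t' u" "\<And>u. u \<in> e \<Longrightarrow> y u = y' u"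
  shows "scaled_dd t M y e = scaled_dd t' M y' e"
proof -
  have "(\<Prod>v\<in>e - {u}. t u - t v) = (\<Prod>v\<in>e - {u}. t' u - t' v)" if "u \<in> e" for u
    using assms(1) that by (intro prod.cong) auto
  thus ?thesis using assms(2) by (simp add: scaled_dd_def dd_weight_def)
qed

lemma scaled_dd_image:
  assumes inj: "inj_on \<phi> e"
  shows "scaled_dd t M y (\<phi> ` e) = scaled_dd (\<lambda>u. t (\<phi> u)) M (\<lambda>u. y (\<phi> u)) e"
proof -
  have "(\<Prod>v\<in>\<phi> ` e - {\<phi> u}. t (\<phi> u) - t v) = (\<Prod>v\<in>e - {u}. t (\<phi> u) - t (\<phi> v))" if "u \<in> e" for u
  proof -
    have "\<phi> ` e - {\<phi> u} = \<phi> ` (e - {u})" using inj that by (auto simp: inj_on_def)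
    thus ?thesis using inj by (simp add: prod.reindex inj_on_diff)
  qed
  thus ?thesis using inj by (simp add: scaled_dd_def dd_weight_def sum.reindex)
qed

section \<open>The graph of a set of residues\<close>

text \<open>The vertex with colour \<open>a\<close> and residue \<open>y\<close>, coded so that the colour is the quotient by \<open>n\<close> and the
  residue is the remainder.\<close>

definition node :: "nat \<Rightarrow> nat \<Rightarrow> int \<Rightarrow> nat" where
  "node n a y = a * n + nat (y mod int n)"

lemma node_div [simp]: "n > 0 \<Longrightarrow> node n a y div n = a"
  by (simp add: node_def nat_less_iff)

lemma node_mod [simp]: "n > 0 \<Longrightarrow> int (node n a y mod n) = y mod int n"
  by (simp add: node_def nat_less_iff)

lemma node_of_div_mod: "node n (v div n) (int (v mod n)) = v"
  by (simp add: node_def flip: of_nat_mod)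

text \<open>The graph is built so that an embedding of \<open>H\<close> is a labelling of its vertices by residues whose
  image under \<open>M D\<close> has all its coordinates in \<open>A\<close>.\<close>

definition residue_graph ::
    "nat \<Rightarrow> nat \<Rightarrow> nat hgraph \<Rightarrow> (nat \<Rightarrow> int) \<Rightarrow> int \<Rightarrow> int set \<Rightarrow> nat hgraph" where
  "residue_graph r n F \<theta> M A =
     \<lparr>verts = (\<lambda>(a, y). node n a y) ` (verts F \<times> {0..<int n}),
      edges = {g. card g = r \<and> (\<lambda>v. v div n) ` g \<in> edges F \<and>
                  scaled_dd (\<lambda>v. \<theta> (v div n)) M (\<lambda>v. int (v mod n)) g mod int n \<in> A}\<rparr>"

lemma verts_residue_graph:
  assumes "n > 0"
  shows "v \<in> verts (residue_graph r n F \<theta> M A) \<longleftrightarrow> v div n \<in> verts F"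
proof
  assume "v div n \<in> verts F"
  hence "(\<lambda>(a, y). node n a y) (v div n, int (v mod n)) \<in> verts (residue_graph r n F \<theta> M A)"
    unfolding residue_graph_def using assms by (simp only: hgraph.select_convs) (rule imageI, simp)
  thus "v \<in> verts (residue_graph r n F \<theta> M A)"
    by (simp only: node_of_div_mod prod.case)
qed (use assms in \<open>auto simp: residue_graph_def\<close>)

lemma card_verts_residue_graph:
  assumes "n > 0"
  shows "card (verts (residue_graph r n F \<theta> M A)) = card (verts F) * n"
proof -
  have "inj_on (\<lambda>(a, y). node n a y) (verts F \<times> {0..<int n})"
  proof (rule inj_onI, clarsimp)
    fix a y b z assume eq: "node n a y = node n b z" and "0 \<le> y" "y < int n" "0 \<le> z" "z < int n"
    have "a = b" using arg_cong[OF eq, of "\<lambda>v. v div n"] assms by simp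
    moreover have "y mod int n = z mod int n"
      using arg_cong[OF eq, of "\<lambda>v. int (v mod n)"] node_mod[OF assms] by simp
    ultimately show "a = b \<and> y = z"
      using \<open>0 \<le> y\<close> \<open>y < int n\<close> \<open>0 \<le> z\<close> \<open>z < int n\<close> by simp
  qed
  thus ?thesis by (simp add: residue_graph_def card_image card_cartesian_product)
qed

lemma r_graph_residue_graph:
  assumes "r_graph r F" "n > 0"
  shows "r_graph r (residue_graph r n F \<theta> M A)"
  unfolding r_graph_def
proof (intro conjI ballI)
  show "finite (verts (residue_graph r n F \<theta> M A))"
    using assms by (simp add: residue_graph_def r_graph_def)
  fix g assume g: "g \<in> edges (residue_graph r n F \<theta> M A)"
  hence "(\<lambda>v. v div n) ` g \<subseteq> verts F"
    using assms by (auto simp: residue_graph_def r_graph_def)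
  thus "g \<subseteq> verts (residue_graph r n F \<theta> M A)"
    using verts_residue_graph[OF assms(2)] by blast
  show "card g = r" using g by (simp add: residue_graph_def)
qed

lemma homomorphism_residue_graph:
  "n > 0 \<Longrightarrow> homomorphism (\<lambda>v. v div n) (residue_graph r n F \<theta> M A) F"
  using verts_residue_graph[of n _ r F \<theta> M A]
  by (auto simp: homomorphism_def residue_graph_def)

lemma image_in_edges_residue_graph:
  assumes n: "n > 0" and col: "\<And>u. u \<in> e \<Longrightarrow> \<phi> u div n = \<sigma> u"
    and inj: "inj_on \<sigma> e"
  shows "\<phi> ` e \<in> edges (residue_graph r n F \<theta> M A) \<longleftrightarrow>
    card e = r \<and> \<sigma> ` e \<in> edges F \<and>
    scaled_dd (\<lambda>u. \<theta> (\<sigma> u)) M (\<lambda>u. int (\<phi> u mod n)) e mod int n \<in> A"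
proof -
  have inj': "inj_on \<phi> e"
    using inj col by (metis inj_onI inj_onD)
  have "(\<lambda>v. v div n) ` \<phi> ` e = \<sigma> ` e" using col by force
  moreover have "scaled_dd (\<lambda>v. \<theta> (v div n)) M (\<lambda>v. int (v mod n)) (\<phi> ` e)
      = scaled_dd (\<lambda>u. \<theta> (\<sigma> u)) M (\<lambda>u. int (\<phi> u mod n)) e"
    unfolding scaled_dd_image[OF inj'] by (rule scaled_dd_cong) (simp_all add: col)
  ultimately show ?thesis by (simp add: residue_graph_def card_image[OF inj'])
qed

text \<open>Multiplication by the unit \<open>M\<close> permutes the residues.\<close>

lemma card_mult_preimage:
  assumes "coprime M (int n)" "n > 0" "A \<subseteq> {0..<int n}"
  shows "card A \<le> card {l\<in>{0..<int n}. (M * l) mod int n \<in> A}"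
proof -
  let ?g = "\<lambda>l. (M * l) mod int n"
  have inj: "inj_on ?g {0..<int n}"
  proof (rule inj_onI)
    fix x y assume xy: "x \<in> {0..<int n}" "y \<in> {0..<int n}" "?g x = ?g y"
    hence "[M * x = M * y] (mod int n)" unfolding cong_def by blast
    hence "[x = y] (mod int n)" using cong_mult_lcancel[OF assms(1)] by blast
    thus "x = y" using xy(1,2) by (simp add: cong_def)
  qed
  have "?g ` {0..<int n} \<subseteq> {0..<int n}" using assms(2) by (intro image_subsetI) simp
  hence surj: "?g ` {0..<int n} = {0..<int n}" by (rule endo_inj_surj[OF finite_atLeastLessThan_int _ inj])
  have sub: "A \<subseteq> ?g ` {l\<in>{0..<int n}. ?g l \<in> A}"
  proof
    fix x assume x: "x \<in> A"
    hence "x \<in> ?g ` {0..<int n}" unfolding surj by (rule subsetD[OF assms(3)])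
    then obtain l where l: "x = ?g l" "l \<in> {0..<int n}" by (rule imageE)
    have "l \<in> {l\<in>{0..<int n}. ?g l \<in> A}" using x l by simp
    thus "x \<in> ?g ` {l\<in>{0..<int n}. ?g l \<in> A}"
      unfolding l(1) by (rule imageI[where f = ?g])
  qed
  have "finite {l\<in>{0..<int n}. ?g l \<in> A}"
    by (rule finite_subset[OF Collect_restrict finite_atLeastLessThan_int])
  thus ?thesis using sub by (rule surj_card_le)
qed

text \<open>The copy of \<open>F\<close> traced out by the polynomial with coefficients \<open>c\<close>; its edges all have the same
  scaled divided difference, \<open>M\<close> times the leading coefficient.\<close>

definition poly_copy :: "nat \<Rightarrow> nat \<Rightarrow> nat set \<Rightarrow> (nat \<Rightarrow> int) \<Rightarrow> (nat \<Rightarrow> int) \<Rightarrow> nat \<Rightarrow> nat" where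
  "poly_copy r n V \<theta> c = (\<lambda>a\<in>V. node n a (power_poly r c (\<theta> a)))"

text \<open>By the leading-coefficient identity, the condition on \<open>c (r - 1)\<close> says that every edge of the
  copy satisfies the edge condition of \<^term>\<open>residue_graph\<close>.\<close>

definition coefficient_vectors :: "nat \<Rightarrow> nat \<Rightarrow> int \<Rightarrow> int set \<Rightarrow> (nat \<Rightarrow> int) set" where
  "coefficient_vectors r n M A =
     {c \<in> {..<r} \<rightarrow>\<^sub>E {0..<int n}. (M * c (r - 1)) mod int n \<in> A}"

lemma poly_copy_embedding:
  assumes n: "n > 0" and r: "r \<ge> 1" and F: "r_graph r F"
    and nd: "\<And>e. e \<in> edges F \<Longrightarrow> nodes_divide \<theta> M e"
    and c: "c \<in> coefficient_vectors r n M A"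
  shows "poly_copy r n (verts F) \<theta> c \<in> embeddings F (residue_graph r n F \<theta> M A)"
proof -
  let ?\<psi> = "poly_copy r n (verts F) \<theta> c"
  have col: "?\<psi> a div n = a" if "a \<in> verts F" for a using that n by (simp add: poly_copy_def)
  have "?\<psi> ` e \<in> edges (residue_graph r n F \<theta> M A)" if e: "e \<in> edges F" for e
  proof -
    have sub: "e \<subseteq> verts F" and ce: "card e = r" using F e by (auto simp: r_graph_def)
    have "[scaled_dd \<theta> M (\<lambda>u. int (?\<psi> u mod n)) e = scaled_dd \<theta> M (\<lambda>u. power_poly r c (\<theta> u)) e] (mod int n)"
      by (rule scaled_dd_cong_mod) (use sub n in \<open>auto simp: poly_copy_def cong_def\<close>)
    also have "scaled_dd \<theta> M (\<lambda>u. power_poly r c (\<theta> u)) e = M * c (r - 1)"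
      using scaled_dd_power_poly[OF nd[OF e], of "r - 1" c] ce r by simp
    finally have "scaled_dd \<theta> M (\<lambda>u. int (?\<psi> u mod n)) e mod int n \<in> A"
      using c by (simp add: cong_def coefficient_vectors_def)
    thus ?thesis
      using image_in_edges_residue_graph[OF n, of e ?\<psi> "\<lambda>a. a" r F \<theta> M A] col sub ce e by auto
  qed
  moreover have "inj_on ?\<psi> (verts F)" using col by (metis inj_onI)
  moreover have "?\<psi> \<in> extensional (verts F)" by (simp add: poly_copy_def)
  ultimately show ?thesis
    using col n by (auto simp: embeddings_def homomorphism_def verts_residue_graph)
qed

text \<open>Two copies that share an edge come from polynomials with \<open>r\<close> coefficients that
  agree modulo \<open>n\<close> at \<open>r\<close> nodes, hence from the same polynomial.\<close>

lemma copies_edge_disjoint: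
  assumes n: "n > 0" and F: "r_graph r F" and cop: "coprime M (int n)"
    and nd: "\<And>e. e \<in> edges F \<Longrightarrow> nodes_divide \<theta> M e"
    and c: "c \<in> coefficient_vectors r n M A" "d \<in> coefficient_vectors r n M A"
    and e: "e \<in> edges F" "e' \<in> edges F"
    and eq: "poly_copy r n (verts F) \<theta> c ` e = poly_copy r n (verts F) \<theta> d ` e'"
  shows "c = d"
proof -
  have sub: "e \<subseteq> verts F" "e' \<subseteq> verts F" and ce: "card e = r"
    using F e by (auto simp: r_graph_def)
  have agree: "[power_poly r c (\<theta> a) = power_poly r d (\<theta> a)] (mod int n)" if a: "a \<in> e" for a
  proof -
    obtain b where b: "b \<in> e'" "poly_copy r n (verts F) \<theta> c a = poly_copy r n (verts F) \<theta> d b"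
      using a eq by (metis imageE imageI)
    hence nodes: "node n a (power_poly r c (\<theta> a)) = node n b (power_poly r d (\<theta> b))"
      using subsetD[OF sub(1) a] subsetD[OF sub(2) b(1)] by (simp add: poly_copy_def)
    have "a = b" using arg_cong[OF nodes, of "\<lambda>v. v div n"] n by simp
    thus ?thesis
      using arg_cong[OF nodes, of "\<lambda>v. int (v mod n)"] node_mod[OF n] by (simp add: cong_def)
  qed
  have cd: "c \<in> {..<r} \<rightarrow>\<^sub>E {0..<int n}" "d \<in> {..<r} \<rightarrow>\<^sub>E {0..<int n}"
    using c by (simp_all add: coefficient_vectors_def)
  show ?thesis
  proof (rule PiE_ext[OF cd])
    fix i assume i: "i \<in> {..<r}"
    have "[c i = d i] (mod int n)"
      using power_poly_determined[OF nd[OF e(1)] ce cop agree] i by simp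
    moreover have "c i \<in> {0..<int n}" "d i \<in> {0..<int n}"
      using PiE_mem[OF cd(1) i] PiE_mem[OF cd(2) i] by simp_all
    ultimately show "c i = d i" by (simp add: cong_def)
  qed
qed

text \<open>The leading coefficient may be chosen in \<open>card A\<close> ways and the \<open>r - 2\<close> middle ones freely; the
  constant term is then fixed by the requirement that the polynomial pass through the given node.\<close>

lemma card_copies_through_node:
  assumes n: "n > 0" and r: "r \<ge> 2" and a: "a \<in> V"
    and cop: "coprime M (int n)" and A: "A \<subseteq> {0..<int n}"
  shows "card A * n ^ (r - 2)
    \<le> card {c \<in> coefficient_vectors r n M A. node n a y \<in> poly_copy r n V \<theta> c ` V}"
proof -
  define A' where "A' = {l\<in>{0..<int n}. (M * l) mod int n \<in> A}"
  define D where "D = (\<lambda>i. if i = r - 1 then A' else {0..<int n})"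
  define g where "g b = (\<lambda>i\<in>{..<r}. if i = 0 then (y - (\<Sum>j\<in>{1..<r}. b j * \<theta> a ^ j)) mod int n
    else b i)" for b
  have "card A * n ^ (r - 2) \<le> card A' * n ^ (r - 2)"
    using card_mult_preimage[OF cop n A] by (simp add: A'_def)
  also have "\<dots> = card (PiE {1..<r} D)"
  proof -
    have "(\<Prod>i\<in>{1..<r}. card (D i)) = card (D (r - 1)) * (\<Prod>i\<in>{1..<r} - {r - 1}. card (D i))"
      using r by (intro prod.remove) auto
    also have "(\<Prod>i\<in>{1..<r} - {r - 1}. card (D i)) = (\<Prod>i\<in>{1..<r} - {r - 1}. n)"
      by (intro prod.cong) (auto simp: D_def)
    also have "\<dots> = n ^ (r - 2)" using r by (simp add: numeral_2_eq_2)
    finally show ?thesis by (simp add: card_PiE D_def)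
  qed
  also have "\<dots> \<le> card {c \<in> coefficient_vectors r n M A. node n a y \<in> poly_copy r n V \<theta> c ` V}"
  proof (rule card_inj_on_le[of g])
    show "inj_on g (PiE {1..<r} D)"
    proof (rule inj_onI)
      fix b b' assume b: "b \<in> PiE {1..<r} D" "b' \<in> PiE {1..<r} D" and eq: "g b = g b'"
      show "b = b'"
      proof (rule PiE_ext[OF b])
        fix i assume "i \<in> {1..<r}"
        thus "b i = b' i" using fun_cong[OF eq, of i] by (simp add: g_def)
      qed
    qed
    have "finite ({..<r} \<rightarrow>\<^sub>E {0..<int n})" by (intro finite_PiE) auto
    thus "finite {c \<in> coefficient_vectors r n M A. node n a y \<in> poly_copy r n V \<theta> c ` V}"
      by (rule rev_finite_subset) (auto simp: coefficient_vectors_def)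
    show "g ` PiE {1..<r} D \<subseteq> {c \<in> coefficient_vectors r n M A. node n a y \<in> poly_copy r n V \<theta> c ` V}"
    proof (rule image_subsetI)
      fix b assume b: "b \<in> PiE {1..<r} D"
      have D_sub: "D i \<subseteq> {0..<int n}" for i by (auto simp: D_def A'_def)
      have "g b \<in> {..<r} \<rightarrow>\<^sub>E {0..<int n}"
      proof (rule PiE_I)
        fix i assume "i \<in> {..<r}"
        thus "g b i \<in> {0..<int n}"
          using PiE_mem[OF b, of i] D_sub[of i] n by (cases "i = 0") (auto simp: g_def)
      qed (simp add: g_def)
      moreover have "g b (r - 1) \<in> A'"
        using PiE_mem[OF b, of "r - 1"] r by (simp add: g_def D_def)
      ultimately have gc: "g b \<in> coefficient_vectors r n M A"
        by (simp add: coefficient_vectors_def A'_def)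
      have split: "{..<r} = insert 0 {1..<r}" using r by auto
      have "power_poly r (g b) (\<theta> a) = g b 0 + (\<Sum>j\<in>{1..<r}. g b j * \<theta> a ^ j)"
        unfolding power_poly_def split by simp
      also have "(\<Sum>j\<in>{1..<r}. g b j * \<theta> a ^ j) = (\<Sum>j\<in>{1..<r}. b j * \<theta> a ^ j)"
        by (intro sum.cong) (auto simp: g_def)
      also have "g b 0 = (y - (\<Sum>j\<in>{1..<r}. b j * \<theta> a ^ j)) mod int n"
        using r by (simp add: g_def)
      finally have "power_poly r (g b) (\<theta> a) mod int n = y mod int n"
        by (simp only: mod_simps diff_add_cancel)
      hence "poly_copy r n V \<theta> (g b) a = node n a y" using a by (simp add: poly_copy_def node_def)
      thus "g b \<in> {c \<in> coefficient_vectors r n M A. node n a y \<in> poly_copy r n V \<theta> c ` V}"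
        using gc a by force
    qed
  qed
  finally show ?thesis .
qed

lemma residue_graph_uniformly_far:
  assumes n: "n > 0" and r: "r \<ge> 2" and F: "r_graph r F" and ne: "edges F \<noteq> {}"
    and nd: "\<And>e. e \<in> edges F \<Longrightarrow> nodes_divide \<theta> M e"
    and cop: "coprime M (int n)" and A: "A \<subseteq> {0..<int n}"
    and \<epsilon>: "\<epsilon> * real (card (verts F) * n) ^ (r - 1) \<le> real (card A * n ^ (r - 2))"
  shows "uniformly_far r F \<epsilon> (residue_graph r n F \<theta> M A) (\<lambda>v. v div n)"
proof -
  let ?G = "residue_graph r n F \<theta> M A"
  let ?Cs = "coefficient_vectors r n M A"
  let ?poly_copy = "poly_copy r n (verts F) \<theta>"
  have disj: "c = d" if "c \<in> ?Cs" "d \<in> ?Cs" "e \<in> edges F" "e' \<in> edges F" "?poly_copy c ` e = ?poly_copy d ` e'"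
    for c d e e'
    using copies_edge_disjoint[OF n F cop nd that] by blast
  hence inj: "inj_on ?poly_copy ?Cs" using ne by (metis all_not_in_conv inj_onI)
  show ?thesis
    unfolding uniformly_far_def
  proof (intro exI[of _ "?poly_copy ` ?Cs"] conjI ballI)
    show "?poly_copy ` ?Cs \<subseteq> embeddings F ?G"
      using poly_copy_embedding[OF n _ F nd] r by auto
    show "disjoint_family_on (\<lambda>\<psi>. (`) \<psi> ` edges F) (?poly_copy ` ?Cs)"
      unfolding disjoint_family_on_def using disj by fast
    show "\<psi> a div n = a" if "\<psi> \<in> ?poly_copy ` ?Cs" "a \<in> verts F" for \<psi> a
      using that n by (auto simp: poly_copy_def)
    fix v assume v: "v \<in> verts ?G"
    have "\<epsilon> * real (card (verts ?G)) ^ (r - 1) \<le> real (card A * n ^ (r - 2))"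
      using \<epsilon> card_verts_residue_graph[OF n] by simp
    also have "card A * n ^ (r - 2) \<le> card {c \<in> ?Cs. v \<in> ?poly_copy c ` verts F}"
      using card_copies_through_node[OF n r _ cop A, of "v div n" "verts F" "int (v mod n)" \<theta>] v
        verts_residue_graph[OF n] node_of_div_mod[of n v] by metis
    also have "card {c \<in> ?Cs. v \<in> ?poly_copy c ` verts F}
        = card (?poly_copy ` {c \<in> ?Cs. v \<in> ?poly_copy c ` verts F})"
      by (rule card_image[symmetric]) (rule inj_on_subset[OF inj], auto)
    also have "?poly_copy ` {c \<in> ?Cs. v \<in> ?poly_copy c ` verts F} = {\<psi> \<in> ?poly_copy ` ?Cs. v \<in> \<psi> ` verts F}"
      by blast
    finally show "\<epsilon> * real (card (verts ?G)) ^ (r - 1) \<le> real (card \<dots>)" by simp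
  qed
qed

text \<open>These are the colour-preserving homomorphisms from \<open>H\<close> to the residue graph, stripped of the
  colours.\<close>

definition good_labellings ::
    "nat \<Rightarrow> 'h hgraph \<Rightarrow> ('h \<Rightarrow> int) \<Rightarrow> int \<Rightarrow> int set \<Rightarrow> ('h \<Rightarrow> int) set" where
  "good_labellings n H t M A =
     {y \<in> verts H \<rightarrow>\<^sub>E {0..<int n}. \<forall>e\<in>edges H. scaled_dd t M y e mod int n \<in> A}"

lemma Emb_le_good_labellings:
  assumes n: "n > 0" and H: "r_graph r H" and inj: "\<And>e. e \<in> edges H \<Longrightarrow> inj_on \<sigma> e"
  shows "Emb H \<sigma> (residue_graph r n F \<theta> M A) (\<lambda>v. v div n)
    \<le> card (good_labellings n H (\<lambda>v. \<theta> (\<sigma> v)) M A)"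
  unfolding Emb_def
proof (rule card_inj_on_le[of "\<lambda>\<phi>. \<lambda>v\<in>verts H. int (\<phi> v mod n)"])
  let ?G = "residue_graph r n F \<theta> M A"
  let ?E = "{\<phi> \<in> embeddings H ?G. \<forall>v\<in>verts H. \<phi> v div n = \<sigma> v}"
  let ?f = "\<lambda>\<phi>. \<lambda>v\<in>verts H. int (\<phi> v mod n)"
  have sub: "e \<subseteq> verts H" if "e \<in> edges H" for e using H that by (auto simp: r_graph_def)
  show "inj_on ?f ?E"
  proof (rule inj_onI)
    fix \<phi> \<phi>' assume \<phi>: "\<phi> \<in> ?E" "\<phi>' \<in> ?E" and eq: "?f \<phi> = ?f \<phi>'"
    show "\<phi> = \<phi>'"
    proof (rule extensionalityI[of _ "verts H"])
      show "\<phi> \<in> extensional (verts H)" "\<phi>' \<in> extensional (verts H)"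
        using \<phi> by (auto simp: embeddings_def)
      fix v assume v: "v \<in> verts H"
      have "\<phi> v mod n = \<phi>' v mod n" using fun_cong[OF eq, of v] v by simp
      moreover have "\<phi> v div n = \<phi>' v div n" using \<phi> v by simp
      ultimately show "\<phi> v = \<phi>' v" by (metis div_mult_mod_eq)
    qed
  qed
  show "?f ` ?E \<subseteq> good_labellings n H (\<lambda>v. \<theta> (\<sigma> v)) M A"
  proof (rule image_subsetI)
    fix \<phi> assume \<phi>: "\<phi> \<in> ?E"
    have "scaled_dd (\<lambda>v. \<theta> (\<sigma> v)) M (?f \<phi>) e mod int n \<in> A" if e: "e \<in> edges H" for e
    proof -
      have "\<phi> ` e \<in> edges ?G" using \<phi> e by (auto simp: embeddings_def homomorphism_def)
      hence "scaled_dd (\<lambda>u. \<theta> (\<sigma> u)) M (\<lambda>u. int (\<phi> u mod n)) e mod int n \<in> A"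
        using image_in_edges_residue_graph[OF n, of e \<phi> \<sigma>] \<phi> sub[OF e] inj[OF e] by blast
      moreover have "scaled_dd (\<lambda>u. \<theta> (\<sigma> u)) M (\<lambda>u. int (\<phi> u mod n)) e = scaled_dd (\<lambda>u. \<theta> (\<sigma> u)) M (?f \<phi>) e"
        by (rule scaled_dd_cong) (use sub[OF e] in auto)
      ultimately show ?thesis by simp
    qed
    thus "?f \<phi> \<in> good_labellings n H (\<lambda>v. \<theta> (\<sigma> v)) M A"
      using n by (auto simp: good_labellings_def)
  qed
  have "finite (verts H \<rightarrow>\<^sub>E {0..<int n})"
    using H by (intro finite_PiE) (auto simp: r_graph_def)
  thus "finite (good_labellings n H (\<lambda>v. \<theta> (\<sigma> v)) M A)"
    by (rule rev_finite_subset) (auto simp: good_labellings_def)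
qed

section \<open>Left inverses with cleared denominators\<close>

definition unit_vec :: "'i \<Rightarrow> 'i \<Rightarrow> 'b::zero_neq_one" where
  "unit_vec u = (\<lambda>v. if v = u then 1 else 0)"

lemma sum_apply_fun: "(\<Sum>i\<in>I. f i) x = (\<Sum>i\<in>I. f i x)"
  by (induction I rule: infinite_finite_induct) auto

lemma rat_space_expansion:
  assumes "finite I" "x \<in> rat_space I"
  shows "x = (\<Sum>i\<in>I. (\<lambda>j. x i * unit_vec i j))"
proof
  fix j
  have "(\<Sum>i\<in>I. x i * unit_vec i j) = (\<Sum>i\<in>I. if j = i then x j else 0)"
    by (intro sum.cong) (auto simp: unit_vec_def)
  also have "\<dots> = x j" using assms by (auto simp: rat_space_def)
  finally show "x j = (\<Sum>i\<in>I. (\<lambda>j. x i * unit_vec i j)) j" by (simp add: sum_apply_fun)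
qed

lemma rat_space_eq_span:
  assumes "finite I"
  shows "rat_space I = ratfun.span (unit_vec ` I)"
proof
  show "rat_space I \<subseteq> ratfun.span (unit_vec ` I)"
  proof
    fix x :: "'a \<Rightarrow> rat" assume "x \<in> rat_space I"
    show "x \<in> ratfun.span (unit_vec ` I)"
      by (subst rat_space_expansion[OF assms \<open>x \<in> rat_space I\<close>])
        (intro ratfun.span_sum ratfun.span_scale ratfun.span_base imageI)
  qed
  show "ratfun.span (unit_vec ` I) \<subseteq> rat_space I"
    by (rule ratfun.span_minimal)
      (auto simp: rat_space_def unit_vec_def ratfun.subspace_def)
qed

lemma linear_Dmap:
  "Vector_Spaces.linear (\<lambda>(c::rat) x i. c * x i) (\<lambda>(c::rat) x i. c * x i) (Dmap H \<sigma> \<theta>)"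
  unfolding Vector_Spaces.linear_iff
proof (intro conjI allI)
  show "Dmap H \<sigma> \<theta> (x + y) = Dmap H \<sigma> \<theta> x + Dmap H \<sigma> \<theta> y" for x y
    by (simp add: fun_eq_iff Dmap_def add_divide_distrib sum.distrib)
  show "Dmap H \<sigma> \<theta> (\<lambda>i. c * x i) = (\<lambda>e. c * Dmap H \<sigma> \<theta> x e)" for c x
    by (simp add: fun_eq_iff Dmap_def sum_distrib_left)
qed (rule ratfun.vector_space_axioms)+

lemma Dimage_eq_span:
  assumes "finite (verts H)"
  shows "Dimage H \<sigma> \<theta> = ratfun.span ((\<lambda>u. Dmap H \<sigma> \<theta> (unit_vec u)) ` verts H)"
proof -
  interpret P: vector_space_pair "\<lambda>(c::rat) (x :: 'a \<Rightarrow> rat) i. c * x i"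
    "\<lambda>(c::rat) (x :: 'a set \<Rightarrow> rat) i. c * x i" ..
  show ?thesis
    unfolding Dimage_def rat_space_eq_span[OF assms] P.linear_span_image[OF linear_Dmap, symmetric]
    by (simp add: image_image)
qed

lemma Dmap_in_rat_space: "Dmap H \<sigma> \<theta> y \<in> rat_space (edges H)"
  by (simp add: Dmap_def rat_space_def)

text \<open>Among the images of the unit vectors, which span the image of \<open>D\<close>, choose a basis, indexed by
  \<open>U\<close>. The map \<open>L\<close> is a linear extension to all of \<open>\<rat>\<^sup>E\<close> of the coordinates in that basis.\<close>

lemma coordinates_on_basis:
  assumes V: "finite (verts H)" and E: "finite (edges H)"
  obtains U L where "U \<subseteq> verts H" "card U = ratfun.dim (Dimage H \<sigma> \<theta>)"
    "\<And>u w. u \<in> U \<Longrightarrow> w \<in> U \<Longrightarrow>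
       (\<Sum>e\<in>edges H. L u e * Dmap H \<sigma> \<theta> (unit_vec w) e) = (if u = w then 1 else 0 :: rat)"
proof -
  let ?f = "\<lambda>u. Dmap H \<sigma> \<theta> (unit_vec u)"
  interpret P: vector_space_pair "\<lambda>(c::rat) (x :: 'a set \<Rightarrow> rat) i. c * x i"
    "\<lambda>(c::rat) (x :: 'a \<Rightarrow> rat) i. c * x i" ..
  obtain X where X: "X \<subseteq> ?f ` verts H" "ratfun.independent X"
    "card X = ratfun.dim (?f ` verts H)"
    by (metis ratfun.basis_exists)
  then obtain U where U: "U \<subseteq> verts H" "inj_on ?f U" "X = ?f ` U"
    by (metis subset_image_inj)
  have "card U = ratfun.dim (Dimage H \<sigma> \<theta>)"
    using X(3) card_image[OF U(2)] U(3) by (simp add: Dimage_eq_span[OF V])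
  obtain g where g: "Vector_Spaces.linear (\<lambda>(c::rat) x i. c * x i) (\<lambda>(c::rat) x i. c * x i) g"
    and gX: "\<forall>x\<in>X. g x = (unit_vec (inv_into U ?f x) :: 'a \<Rightarrow> rat)"
    using P.linear_independent_extend[OF X(2), of "\<lambda>x. unit_vec (inv_into U ?f x)"] by blast
  have g_expand: "g x u = (\<Sum>e\<in>edges H. g (unit_vec e) u * x e)" if "x \<in> rat_space (edges H)" for x u
  proof -
    have "g x = g (\<Sum>e\<in>edges H. (\<lambda>j. x e * unit_vec e j))"
      using rat_space_expansion[OF E that] by simp
    also have "\<dots> = (\<Sum>e\<in>edges H. (\<lambda>i. x e * g (unit_vec e) i))"
      by (simp add: P.linear_sum[OF g] P.linear_scale[OF g])
    finally show ?thesis by (simp add: sum_apply_fun mult.commute)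
  qed
  show thesis
  proof (rule that[of U "\<lambda>u e. g (unit_vec e) u"])
    fix u w assume "u \<in> U" "w \<in> U"
    have "g (?f w) = unit_vec w" using gX U \<open>w \<in> U\<close> inv_into_f_f[OF U(2) \<open>w \<in> U\<close>] by simp
    thus "(\<Sum>e\<in>edges H. g (unit_vec e) u * ?f w e) = (if u = w then 1 else 0)"
      using g_expand[OF Dmap_in_rat_space[of H \<sigma> \<theta> "unit_vec w"], of u] by (simp add: unit_vec_def)
  qed fact+
qed

lemma common_denominator:
  assumes "finite I"
  obtains N :: int and K where "N > 0" "\<And>i. i \<in> I \<Longrightarrow> rat_of_int (K i) = of_int N * x i"
proof -
  have "\<exists>N>0. \<exists>K. \<forall>i\<in>I. rat_of_int (K i) = of_int N * x i"
    using assms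
  proof (induction I)
    case (insert i I)
    then obtain N K where N: "N > 0" "\<forall>i\<in>I. rat_of_int (K i) = of_int N * x i" by blast
    obtain a b where ab: "b > 0" "x i = rat_of_int a / of_int b"
      by (metis quotient_of_denom_pos' quotient_of_div surj_pair snd_conv)
    define K' where "K' j = (if j = i then N * a else b * K j)" for j
    have "N * b > 0" using N(1) ab(1) by simp
    moreover have "\<forall>j\<in>insert i I. rat_of_int (K' j) = of_int (N * b) * x j"
    proof
      fix j assume "j \<in> insert i I"
      thus "rat_of_int (K' j) = of_int (N * b) * x j"
        using N(2) ab by (cases "j = i") (simp_all add: K'_def)
    qed
    ultimately show ?case by blast
  next
    case empty
    show ?case by (rule exI[of _ 1]) simp
  qed
  thus thesis using that by blast
qed

lemma Dmap_scaled:
  assumes "e \<in> edges H" "nodes_divide (\<lambda>v. \<theta> (\<sigma> v)) M e" "\<And>u. u \<in> e \<Longrightarrow> z u = of_int (y u)"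
  shows "of_int M * Dmap H \<sigma> \<theta> z e = rat_of_int (scaled_dd (\<lambda>v. \<theta> (\<sigma> v)) M y e)"
proof -
  let ?w = "\<lambda>u. \<Prod>v\<in>e - {u}. rat_of_int (\<theta> (\<sigma> u)) - of_int (\<theta> (\<sigma> v))"
  have "of_int M * Dmap H \<sigma> \<theta> z e = (\<Sum>u\<in>e. of_int M * (z u / ?w u))"
    using assms(1) by (simp add: Dmap_def sum_distrib_left)
  also have "\<dots> = (\<Sum>u\<in>e. rat_of_int (dd_weight (\<lambda>v. \<theta> (\<sigma> v)) M e u * y u))"
    by (intro sum.cong refl) (simp add: of_int_weight[OF assms(2)] assms(3))
  finally show ?thesis by (simp add: scaled_dd_def)
qed

text \<open>The left inverse with its denominators cleared survives reduction modulo any \<open>n\<close> coprime to \<open>N M\<close>.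
  It bounds the fibres of \<open>M D\<close> modulo \<open>n\<close>, because a vector of residues is then determined by its
  image and its coordinates outside \<open>U\<close>.\<close>

lemma integral_left_inverse:
  assumes V: "finite (verts H)" and E: "finite (edges H)"
    and nd: "\<And>e. e \<in> edges H \<Longrightarrow> nodes_divide (\<lambda>v. \<theta> (\<sigma> v)) M e"
  obtains U and N :: int and K where "U \<subseteq> verts H" "card U = ratfun.dim (Dimage H \<sigma> \<theta>)" "N > 0"
    "\<forall>u\<in>U. \<forall>w\<in>U.
       (\<Sum>e\<in>edges H. K u e * scaled_dd (\<lambda>v. \<theta> (\<sigma> v)) M (unit_vec w) e) = (if u = w then N * M else 0)"
proof -
  obtain U L where U: "U \<subseteq> verts H" "card U = ratfun.dim (Dimage H \<sigma> \<theta>)"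
    and L: "\<And>u w. u \<in> U \<Longrightarrow> w \<in> U \<Longrightarrow>
       (\<Sum>e\<in>edges H. L u e * Dmap H \<sigma> \<theta> (unit_vec w) e) = (if u = w then 1 else 0 :: rat)"
    by (rule coordinates_on_basis[OF V E, of \<sigma> \<theta>]) blast
  have "finite (U \<times> edges H)" using V E U(1) by (auto intro: finite_subset)
  then obtain N :: int and K where N: "N > 0"
    and K: "\<And>i. i \<in> U \<times> edges H \<Longrightarrow> rat_of_int (K i) = of_int N * (\<lambda>(u, e). L u e) i"
    by (rule common_denominator[where x = "\<lambda>(u, e). L u e"]) blast
  show thesis
  proof (rule that[OF U N, of "\<lambda>u e. K (u, e)"], intro ballI)
    fix u w assume u: "u \<in> U" and w: "w \<in> U"
    have "rat_of_int (\<Sum>e\<in>edges H. K (u, e) * scaled_dd (\<lambda>v. \<theta> (\<sigma> v)) M (unit_vec w) e)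
        = (\<Sum>e\<in>edges H. of_int N * L u e * (of_int M * Dmap H \<sigma> \<theta> (unit_vec w) e))"
      unfolding of_int_sum of_int_mult
    proof (intro sum.cong refl arg_cong2[of _ _ _ _ "(*)"])
      fix e assume e: "e \<in> edges H"
      show "rat_of_int (K (u, e)) = of_int N * L u e" using K[of "(u, e)"] u e by simp
      show "rat_of_int (scaled_dd (\<lambda>v. \<theta> (\<sigma> v)) M (unit_vec w) e) = of_int M * Dmap H \<sigma> \<theta> (unit_vec w) e"
        by (rule Dmap_scaled[symmetric, of e H \<theta> \<sigma> M, OF e nd[OF e]]) (simp add: unit_vec_def)
    qed
    also have "\<dots> = of_int N * of_int M * (\<Sum>e\<in>edges H. L u e * Dmap H \<sigma> \<theta> (unit_vec w) e)"
      by (simp add: sum_distrib_left mult_ac)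
    also have "\<dots> = rat_of_int (if u = w then N * M else 0)"
      by (simp add: L[OF u w])
    finally show "(\<Sum>e\<in>edges H. K (u, e) * scaled_dd (\<lambda>v. \<theta> (\<sigma> v)) M (unit_vec w) e)
        = (if u = w then N * M else 0)" by (simp only: of_int_eq_iff)
  qed
qed

section \<open>Counting solutions modulo n\<close>

lemma scaled_dd_split:
  assumes "finite e" "u \<in> e"
  shows "scaled_dd t M y e = dd_weight t M e u * y u + (\<Sum>v\<in>e - {u}. dd_weight t M e v * y v)"
  unfolding scaled_dd_def using assms by (rule sum.remove)

text \<open>An equality between two coordinates of the image is a linear equation in \<open>y\<close> in which \<open>y u\<close> has a
  unit coefficient, so the other coordinates determine \<open>y u\<close>.\<close>

lemma card_coincidences:
  assumes nd: "nodes_divide t M e" and u: "u \<in> e" "u \<notin> e'" and V: "finite V" "e \<subseteq> V" "e' \<subseteq> V"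
    and cop: "coprime M (int n)"
  shows "card {y \<in> V \<rightarrow>\<^sub>E {0..<int n}. scaled_dd t M y e mod int n = scaled_dd t M y e' mod int n}
    \<le> n ^ (card V - 1)"
proof -
  let ?Z = "{y \<in> V \<rightarrow>\<^sub>E {0..<int n}. scaled_dd t M y e mod int n = scaled_dd t M y e' mod int n}"
  have "card ?Z \<le> card ((V - {u}) \<rightarrow>\<^sub>E {0..<int n})"
  proof (rule card_inj_on_le[of "\<lambda>y. restrict y (V - {u})"])
    show "inj_on (\<lambda>y. restrict y (V - {u})) ?Z"
    proof (rule inj_onI)
      fix y z assume y: "y \<in> ?Z" and z: "z \<in> ?Z" and eq: "restrict y (V - {u}) = restrict z (V - {u})"
      have yz: "y v = z v" if "v \<in> V - {u}" for v
        using fun_cong[OF eq, of v] that by simp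
      have "scaled_dd t M y e' = scaled_dd t M z e'"
        by (rule scaled_dd_cong) (use yz u V in auto)
      hence "[scaled_dd t M y e = scaled_dd t M z e] (mod int n)"
        using y z by (simp add: cong_def)
      moreover have "(\<Sum>v\<in>e - {u}. dd_weight t M e v * y v) = (\<Sum>v\<in>e - {u}. dd_weight t M e v * z v)"
        by (intro sum.cong) (use yz V in auto)
      ultimately have "[dd_weight t M e u * y u = dd_weight t M e u * z u] (mod int n)"
        using nd u by (simp add: scaled_dd_split nodes_divide_def cong_add_rcancel)
      moreover have "coprime (dd_weight t M e u) (int n)"
        using dd_weight_dvd[OF nd u(1)] cop by (meson coprime_divisors dvd_refl)
      ultimately have cu: "[y u = z u] (mod int n)" using cong_mult_lcancel by blast
      have yP: "y \<in> V \<rightarrow>\<^sub>E {0..<int n}" and zP: "z \<in> V \<rightarrow>\<^sub>E {0..<int n}" using y z by simp_all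
      have uV: "u \<in> V" using u V by blast
      have "y u = z u"
        using cu PiE_mem[OF yP uV] PiE_mem[OF zP uV] by (simp add: cong_def)
      show "y = z"
      proof (rule PiE_ext[OF yP zP])
        fix v assume "v \<in> V"
        thus "y v = z v" using yz \<open>y u = z u\<close> by (cases "v = u") simp_all
      qed
    qed
    show "(\<lambda>y. restrict y (V - {u})) ` ?Z \<subseteq> (V - {u}) \<rightarrow>\<^sub>E {0..<int n}"
      by (rule image_subsetI, rule restrict_PiE_iff[THEN iffD2]) (auto simp: PiE_def Pi_def)
    show "finite ((V - {u}) \<rightarrow>\<^sub>E {0..<int n})" using V by (intro finite_PiE) auto
  qed
  also have "\<dots> = n ^ (card V - 1)"
    using V u by (subst card_PiE) (auto simp: card_Diff_singleton)
  finally show ?thesis .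
qed

definition proper_labellings ::
    "nat \<Rightarrow> 'h hgraph \<Rightarrow> ('h \<Rightarrow> int) \<Rightarrow> int \<Rightarrow> int set \<Rightarrow> ('h \<Rightarrow> int) set" where
  "proper_labellings n H t M A =
     {y \<in> good_labellings n H t M A. inj_on (\<lambda>e. scaled_dd t M y e mod int n) (edges H)}"

lemma finite_good_labellings: "finite (verts H) \<Longrightarrow> finite (good_labellings n H t M A)"
  by (rule finite_subset[of _ "verts H \<rightarrow>\<^sub>E {0..<int n}"])
    (auto simp: good_labellings_def intro: finite_PiE)

text \<open>All edges have the same size, so of two distinct ones each has a vertex outside the other, and
  each pair of edges spoils at most \<open>n ^ (card (verts H) - 1)\<close> labellings.\<close>

lemma good_le_proper_labellings:
  assumes H: "r_graph r H" and nd: "\<And>e. e \<in> edges H \<Longrightarrow> nodes_divide t M e"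
    and cop: "coprime M (int n)"
  shows "card (good_labellings n H t M A)
    \<le> card (proper_labellings n H t M A) + card (edges H) ^ 2 * n ^ (card (verts H) - 1)"
proof -
  let ?V = "verts H" and ?E = "edges H"
  let ?pairs = "{(e, e') \<in> ?E \<times> ?E. e \<noteq> e'}"
  let ?Z = "\<lambda>(e, e'). {y \<in> ?V \<rightarrow>\<^sub>E {0..<int n}. scaled_dd t M y e mod int n = scaled_dd t M y e' mod int n}"
  have fV: "finite ?V" and sub: "\<And>e. e \<in> ?E \<Longrightarrow> e \<subseteq> ?V" and ce: "\<And>e. e \<in> ?E \<Longrightarrow> card e = r"
    using H by (auto simp: r_graph_def)
  have fE: "finite ?E" using fV sub by (meson finite_Pow_iff finite_subset PowI subsetI)
  have Zcard: "card (?Z p) \<le> n ^ (card ?V - 1)" if p: "p \<in> ?pairs" for p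
  proof -
    obtain e e' where ee: "p = (e, e')" "e \<in> ?E" "e' \<in> ?E" "e \<noteq> e'" using p by auto
    have "finite e'" using sub[OF ee(3)] fV by (rule finite_subset)
    hence "\<not> e \<subseteq> e'" using ce[OF ee(2)] ce[OF ee(3)] ee(4) by (metis card_subset_eq)
    then obtain u where u: "u \<in> e" "u \<notin> e'" by blast
    show ?thesis
      using card_coincidences[OF nd[OF ee(2)] u fV sub[OF ee(2)] sub[OF ee(3)] cop] ee(1) by simp
  qed
  have fP: "finite ?pairs" by (rule finite_subset[of _ "?E \<times> ?E"]) (use fE in auto)
  have "good_labellings n H t M A \<subseteq> proper_labellings n H t M A \<union> (\<Union>p\<in>?pairs. ?Z p)"
  proof
    fix y assume y: "y \<in> good_labellings n H t M A"
    show "y \<in> proper_labellings n H t M A \<union> (\<Union>p\<in>?pairs. ?Z p)"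
    proof (cases "inj_on (\<lambda>e. scaled_dd t M y e mod int n) ?E")
      case False
      then obtain e e' where "e \<in> ?E" "e' \<in> ?E" "e \<noteq> e'"
        "scaled_dd t M y e mod int n = scaled_dd t M y e' mod int n"
        unfolding inj_on_def by blast
      hence "(e, e') \<in> ?pairs" "y \<in> ?Z (e, e')" using y by (auto simp: good_labellings_def)
      thus ?thesis by blast
    qed (use y in \<open>simp add: proper_labellings_def\<close>)
  qed
  moreover have "finite (proper_labellings n H t M A)"
    by (rule finite_subset[OF _ finite_good_labellings[OF fV]]) (auto simp: proper_labellings_def)
  moreover have "finite (\<Union>p\<in>?pairs. ?Z p)"
    by (rule finite_subset[of _ "?V \<rightarrow>\<^sub>E {0..<int n}"]) (auto intro: finite_PiE fV)
  ultimately have "card (good_labellings n H t M A)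
      \<le> card (proper_labellings n H t M A \<union> (\<Union>p\<in>?pairs. ?Z p))"
    by (intro card_mono finite_UnI)
  also have "\<dots> \<le> card (proper_labellings n H t M A) + card (\<Union>p\<in>?pairs. ?Z p)"
    by (rule card_Un_le)
  also have "card (\<Union>p\<in>?pairs. ?Z p) \<le> (\<Sum>p\<in>?pairs. card (?Z p))"
    by (rule card_UN_le[OF fP])
  also have "\<dots> \<le> (\<Sum>p\<in>?pairs. n ^ (card ?V - 1))"
    by (rule sum_mono) (rule Zcard)
  also have "\<dots> = card ?pairs * n ^ (card ?V - 1)" by simp
  also have "card ?pairs \<le> card (?E \<times> ?E)" by (rule card_mono) (use fE in auto)
  also have "card (?E \<times> ?E) = card ?E ^ 2" by (simp add: card_cartesian_product power2_eq_square)
  finally show ?thesis by simp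
qed

text \<open>The image of a labelling under \<open>M D\<close> is a solution, and together with the labels outside \<open>U\<close> it
  determines the labelling.\<close>

lemma labellings_le_solutions:
  assumes n: "n > 0" and H: "r_graph r H" and UV: "U \<subseteq> verts H" and cop: "coprime P (int n)"
    and K: "\<And>u w. u \<in> U \<Longrightarrow> w \<in> U \<Longrightarrow>
       (\<Sum>e\<in>edges H. K u e * scaled_dd t M (unit_vec w) e) = (if u = w then P else 0)"
    and B: "\<And>j y. j < k \<Longrightarrow> (\<Sum>e\<in>edges H. B j e * scaled_dd t M y e) = 0"
    and A: "A \<subseteq> {0..<int n}"
  shows "card (proper_labellings n H t M A)
    \<le> card {x \<in> ker_mod n k (edges H) (mat_mod B n) \<inter> (edges H \<rightarrow>\<^sub>E A). proper (edges H) x}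
        * n ^ (card (verts H) - card U)"
proof -
  let ?V = "verts H" and ?E = "edges H"
  let ?X = "{x \<in> ker_mod n k ?E (mat_mod B n) \<inter> (?E \<rightarrow>\<^sub>E A). proper ?E x}"
  let ?R = "(?V - U) \<rightarrow>\<^sub>E {0..<int n}"
  let ?x = "\<lambda>y. \<lambda>e\<in>?E. scaled_dd t M y e mod int n"
  have fV: "finite ?V" and sub: "\<And>e. e \<in> ?E \<Longrightarrow> e \<subseteq> ?V" using H by (auto simp: r_graph_def)
  have fE: "finite ?E" using fV sub by (meson finite_Pow_iff finite_subset PowI subsetI)
  have fU: "finite U" using UV fV by (rule finite_subset)
  have "card (proper_labellings n H t M A) \<le> card (?X \<times> ?R)"
  proof (rule card_inj_on_le[of "\<lambda>y. (?x y, restrict y (?V - U))"])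
    show "inj_on (\<lambda>y. (?x y, restrict y (?V - U))) (proper_labellings n H t M A)"
    proof (rule inj_onI)
      fix y z assume y: "y \<in> proper_labellings n H t M A" and z: "z \<in> proper_labellings n H t M A"
        and eq: "(?x y, restrict y (?V - U)) = (?x z, restrict z (?V - U))"
      have yP: "y \<in> ?V \<rightarrow>\<^sub>E {0..<int n}" and zP: "z \<in> ?V \<rightarrow>\<^sub>E {0..<int n}"
        using y z by (simp_all add: proper_labellings_def good_labellings_def)
      have off: "y v = z v" if "v \<in> ?V - U" for v
        using fun_cong[OF conjunct2[OF eq[unfolded prod.inject]], of v] that by simp
      \<comment> \<open>The difference is exactly zero, not only modulo \<open>n\<close>, outside \<open>U\<close>, so it expands over \<open>U\<close>.\<close>
      define d where "d v = y v - z v" for v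
      have dcong: "[scaled_dd t M d e = 0] (mod int n)" if e: "e \<in> ?E" for e
      proof -
        have "[scaled_dd t M y e = scaled_dd t M z e] (mod int n)"
          using fun_cong[OF conjunct1[OF eq[unfolded prod.inject]], of e] e by (simp add: cong_def)
        moreover have "scaled_dd t M d e = scaled_dd t M y e - scaled_dd t M z e"
          by (simp add: scaled_dd_def d_def right_diff_distrib sum_subtractf)
        ultimately show ?thesis by (simp add: cong_diff_iff_cong_0)
      qed
      have dexp: "scaled_dd t M d e = (\<Sum>w\<in>U. d w * scaled_dd t M (unit_vec w) e)" if e: "e \<in> ?E" for e
      proof -
        have "d v = (\<Sum>w\<in>U. d w * unit_vec w v)" if "v \<in> e" for v
        proof -
          have "(\<Sum>w\<in>U. d w * unit_vec w v) = (\<Sum>w\<in>U. if v = w then d v else 0)"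
            by (intro sum.cong) (auto simp: unit_vec_def)
          also have "\<dots> = d v" using that sub[OF e] off[of v] fU by (auto simp: d_def)
          finally show ?thesis by simp
        qed
        hence "scaled_dd t M d e = (\<Sum>v\<in>e. dd_weight t M e v * (\<Sum>w\<in>U. d w * unit_vec w v))"
          unfolding scaled_dd_def by (intro sum.cong) auto
        also have "\<dots> = (\<Sum>w\<in>U. d w * scaled_dd t M (unit_vec w) e)"
          unfolding scaled_dd_def sum_distrib_left by (subst sum.swap) (simp add: mult_ac)
        finally show ?thesis .
      qed
      have on: "[y u = z u] (mod int n)" if u: "u \<in> U" for u
      proof -
        have "(\<Sum>e\<in>?E. K u e * scaled_dd t M d e)
            = (\<Sum>e\<in>?E. \<Sum>w\<in>U. d w * (K u e * scaled_dd t M (unit_vec w) e))"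
          by (intro sum.cong refl) (simp add: dexp sum_distrib_left mult_ac)
        also have "\<dots> = (\<Sum>w\<in>U. d w * (\<Sum>e\<in>?E. K u e * scaled_dd t M (unit_vec w) e))"
          unfolding sum_distrib_left by (rule sum.swap)
        also have "\<dots> = (\<Sum>w\<in>U. if u = w then d u * P else 0)"
          by (intro sum.cong refl) (simp add: K[OF u])
        also have "\<dots> = P * d u" using u fU by simp
        finally have "P * d u = (\<Sum>e\<in>?E. K u e * scaled_dd t M d e)" by simp
        moreover have "[(\<Sum>e\<in>?E. K u e * scaled_dd t M d e) = (\<Sum>e\<in>?E. K u e * 0)] (mod int n)"
          by (intro cong_sum cong_mult cong_refl dcong)
        ultimately have "[P * d u = P * 0] (mod int n)" by simp
        hence "[d u = 0] (mod int n)" using cong_mult_lcancel[OF cop] by blast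
        thus ?thesis by (simp add: d_def cong_diff_iff_cong_0)
      qed
      show "y = z"
      proof (rule PiE_ext[OF yP zP])
        fix v assume v: "v \<in> ?V"
        show "y v = z v"
        proof (cases "v \<in> U")
          case True
          thus ?thesis using on[OF True] PiE_mem[OF yP v] PiE_mem[OF zP v] by (simp add: cong_def)
        qed (use v off in simp)
      qed
    qed
    show "(\<lambda>y. (?x y, restrict y (?V - U))) ` proper_labellings n H t M A \<subseteq> ?X \<times> ?R"
    proof (rule image_subsetI)
      fix y assume y: "y \<in> proper_labellings n H t M A"
      have yP: "y \<in> ?V \<rightarrow>\<^sub>E {0..<int n}"
        and yA: "\<And>e. e \<in> ?E \<Longrightarrow> scaled_dd t M y e mod int n \<in> A"
        and yI: "inj_on (\<lambda>e. scaled_dd t M y e mod int n) ?E"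
        using y by (simp_all add: proper_labellings_def good_labellings_def)
      have "restrict y (?V - U) \<in> ?R"
        using yP by (auto simp: PiE_def Pi_def)
      moreover have "proper ?E (?x y)"
        using yI by (simp add: proper_def inj_on_def)
      moreover have xA: "?x y \<in> ?E \<rightarrow>\<^sub>E A" using yA by simp
      moreover have "?x y \<in> ker_mod n k ?E (mat_mod B n)"
        unfolding ker_mod_def
      proof (intro CollectI conjI allI impI)
        show "?x y \<in> ?E \<rightarrow>\<^sub>E {0..<int n}" using n by simp
        fix j assume j: "j < k"
        have "[mat_vec ?E (mat_mod B n) (?x y) j = (\<Sum>e\<in>?E. B j e * scaled_dd t M y e)] (mod int n)"
          unfolding mat_vec_def mat_mod_def
          by (intro cong_sum cong_mult) (simp_all add: cong_def)
        thus "[mat_vec ?E (mat_mod B n) (?x y) j = 0] (mod int n)" by (simp only: B[OF j])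
      qed
      ultimately show "(?x y, restrict y (?V - U)) \<in> ?X \<times> ?R" by blast
    qed
    have "finite A" using A by (rule finite_subset) simp
    hence "finite (?E \<rightarrow>\<^sub>E A)" using fE by (intro finite_PiE) auto
    hence "finite ?X" by (rule rev_finite_subset) auto
    moreover have "finite ?R" using fV by (intro finite_PiE) auto
    ultimately show "finite (?X \<times> ?R)" by (rule finite_cartesian_product)
  qed
  also have "card (?X \<times> ?R) = card ?X * n ^ card (?V - U)"
    using fV by (simp add: card_cartesian_product card_PiE)
  also have "card (?V - U) = card ?V - card U" using UV fU by (rule card_Diff_subset[rotated])
  finally show ?thesis .
qed

lemma ker_rat_annihilates_sdd:
  assumes H: "r_graph r H" and ker: "ker_rat k (edges H) B = Dimage H \<sigma> \<theta>" and j: "j < k"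
    and nd: "\<And>e. e \<in> edges H \<Longrightarrow> nodes_divide (\<lambda>v. \<theta> (\<sigma> v)) M e"
  shows "(\<Sum>e\<in>edges H. B j e * scaled_dd (\<lambda>v. \<theta> (\<sigma> v)) M y e) = 0"
proof -
  define z where "z = (\<lambda>v. if v \<in> verts H then rat_of_int (y v) else 0)"
  have "Dmap H \<sigma> \<theta> z \<in> ker_rat k (edges H) B"
    unfolding ker Dimage_def by (rule imageI) (simp add: rat_space_def z_def)
  hence "(\<Sum>e\<in>edges H. of_int (B j e) * Dmap H \<sigma> \<theta> z e) = 0"
    using j by (simp add: ker_rat_def mat_vec_def)
  hence "0 = of_int M * (\<Sum>e\<in>edges H. of_int (B j e) * Dmap H \<sigma> \<theta> z e)" by simp
  also have "\<dots> = (\<Sum>e\<in>edges H. of_int (B j e) * (of_int M * Dmap H \<sigma> \<theta> z e))"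
    by (simp add: sum_distrib_left mult_ac)
  also have "\<dots> = (\<Sum>e\<in>edges H. of_int (B j e) * rat_of_int (scaled_dd (\<lambda>v. \<theta> (\<sigma> v)) M y e))"
  proof (intro sum.cong refl arg_cong2[of _ _ _ _ "(*)"])
    fix e assume e: "e \<in> edges H"
    have "e \<subseteq> verts H" using H e by (auto simp: r_graph_def)
    thus "of_int M * Dmap H \<sigma> \<theta> z e = rat_of_int (scaled_dd (\<lambda>v. \<theta> (\<sigma> v)) M y e)"
      by (intro Dmap_scaled[of e H \<theta> \<sigma> M, OF e nd[OF e]]) (auto simp: z_def)
  qed
  also have "\<dots> = rat_of_int (\<Sum>e\<in>edges H. B j e * scaled_dd (\<lambda>v. \<theta> (\<sigma> v)) M y e)" by simp
  finally show ?thesis by (simp only: of_int_eq_0_iff)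
qed

text \<open>The all-one vector is the image under \<open>D\<close> of the labelling \<open>u \<mapsto> \<theta>(\<sigma>(u))\<^sup>r\<^sup>-\<^sup>1\<close>.\<close>

lemma ker_rat_row_sums_zero:
  assumes H: "r_graph r H" and r: "r \<ge> 1" and ker: "ker_rat k (edges H) B = Dimage H \<sigma> \<theta>"
    and j: "j < k" and inj: "\<And>e. e \<in> edges H \<Longrightarrow> inj_on (\<lambda>v. \<theta> (\<sigma> v)) e"
  shows "mat_vec (edges H) B (\<lambda>_. 1) j = 0"
proof -
  define z where "z = (\<lambda>v. if v \<in> verts H then rat_of_int (\<theta> (\<sigma> v)) ^ (r - 1) else 0)"
  have one: "Dmap H \<sigma> \<theta> z e = 1" if e: "e \<in> edges H" for e
  proof -
    let ?t = "\<lambda>v. rat_of_int (\<theta> (\<sigma> v))"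
    have sub: "e \<subseteq> verts H" and ce: "card e = r" using H e by (auto simp: r_graph_def)
    have "finite e" using ce r by (intro card_ge_0_finite) simp
    moreover have "inj_on ?t e" using inj[OF e] by (simp add: inj_on_def)
    ultimately have "(\<Sum>u\<in>e. ?t u ^ (r - 1) / (\<Prod>v\<in>e - {u}. ?t u - ?t v)) = 1"
      using lagrange_leading_coefficient[of e ?t "r - 1"] ce r by simp
    moreover have "(\<Sum>u\<in>e. z u / (\<Prod>v\<in>e - {u}. ?t u - ?t v))
        = (\<Sum>u\<in>e. ?t u ^ (r - 1) / (\<Prod>v\<in>e - {u}. ?t u - ?t v))"
      by (intro sum.cong refl) (use sub in \<open>auto simp: z_def\<close>)
    ultimately show ?thesis using e by (simp add: Dmap_def)
  qed
  have "Dmap H \<sigma> \<theta> z \<in> ker_rat k (edges H) B"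
    unfolding ker Dimage_def by (rule imageI) (simp add: rat_space_def z_def)
  hence "(\<Sum>e\<in>edges H. of_int (B j e) * Dmap H \<sigma> \<theta> z e) = 0"
    using j by (simp add: ker_rat_def mat_vec_def)
  hence "rat_of_int (\<Sum>e\<in>edges H. B j e) = 0" by (simp add: one)
  thus ?thesis by (simp only: of_int_eq_0_iff mat_vec_def mult_1_right)
qed

section \<open>Solutions in dense sets\<close>

text \<open>The modulus is an arbitrary large integer coprime to a constant \<open>W\<close>, which covers both parts of
  the theorem: large primes for the statement over \<open>\<int>/p\<close>, and an integer of the form \<open>W b N + 1\<close> for
  the one over \<open>{1..N}\<close>. The factor \<open>q\<close> below converts densities in \<open>\<int>/n\<close> into the parameter of
  uniform farness of a graph with \<open>f n\<close> vertices; half of the embeddings are given up to discard labellings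
  whose solution is not proper.\<close>

lemma proper_solutions_modulo:
  fixes r f k :: nat and F :: "nat hgraph" and H :: "'h hgraph" and \<sigma> :: "'h \<Rightarrow> nat"
    and \<theta> :: "nat \<Rightarrow> int" and B :: "nat \<Rightarrow> 'h set \<Rightarrow> int" and c C :: real
  assumes r: "r \<ge> 2" and F: "r_graph r F" and VF: "verts F = {1..f}" and ne: "edges F \<noteq> {}"
    and H: "r_graph r H" and hom: "homomorphism \<sigma> H F" and inj: "inj_on \<theta> {1..f}"
    and ker: "ker_rat k (edges H) B = Dimage H \<sigma> \<theta>" and c: "c > 0"
    and count: "\<forall>\<epsilon>::real. 0 < \<epsilon> \<and> \<epsilon> \<le> 1 \<longrightarrow>
      (\<exists>n0::nat. \<forall>(G :: nat hgraph) \<kappa>.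
         r_graph r G \<and> homomorphism \<kappa> G F \<and> uniformly_far r F \<epsilon> G \<kappa> \<and> card (verts G) \<ge> n0 \<longrightarrow>
         real (Emb H \<sigma> G \<kappa>) \<ge> c * \<epsilon> powr C * real (card (verts G)) ^ card (verts H))"
  shows "\<exists>W::nat. \<exists>c1::real. W > 0 \<and> c1 > 0 \<and> (\<forall>\<delta>>0. \<exists>n0. \<forall>n\<ge>n0. coprime W n \<longrightarrow>
    (\<forall>A. A \<subseteq> {0..<int n} \<and> real (card A) \<ge> \<delta> * real n \<longrightarrow>
      real (card {x \<in> ker_mod n k (edges H) (mat_mod B n) \<inter> (edges H \<rightarrow>\<^sub>E A). proper (edges H) x})
        \<ge> c1 * \<delta> powr C * real n ^ ratfun.dim (Dimage H \<sigma> \<theta>)))"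
proof -
  let ?t = "\<lambda>v. \<theta> (\<sigma> v)"
  let ?h = "card (verts H)" and ?m = "card (edges H)"
  let ?s = "ratfun.dim (Dimage H \<sigma> \<theta>)"
  define M where "M = node_product {1..f} \<theta>"
  have M0: "M \<noteq> 0" unfolding M_def by (rule node_product_nonzero) (use inj in auto)
  have F_sub: "e \<subseteq> {1..f}" "card e = r" if "e \<in> edges F" for e
    using F VF that by (auto simp: r_graph_def)
  have H_sub: "e \<subseteq> verts H" "card e = r" if "e \<in> edges H" for e
    using H that by (auto simp: r_graph_def)
  have fV: "finite (verts H)" using H by (simp add: r_graph_def)
  have fE: "finite (edges H)" using fV H_sub(1) by (meson finite_Pow_iff finite_subset PowI subsetI)
  have ndF: "nodes_divide \<theta> M e" if e: "e \<in> edges F" for e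
    using node_product_divisible[of "{1..f}" \<theta> e "\<lambda>a. a"] F_sub(1)[OF e] inj
      finite_subset[OF F_sub(1)[OF e]] by (simp add: M_def)
  have \<sigma>e: "\<sigma> ` e \<in> edges F" if "e \<in> edges H" for e
    using hom that by (simp add: homomorphism_def)
  have inj\<sigma>: "inj_on \<sigma> e" if e: "e \<in> edges H" for e
    using F_sub(2)[OF \<sigma>e[OF e]] H_sub(2)[OF e] finite_subset[OF H_sub(1)[OF e] fV]
    by (simp add: eq_card_imp_inj_on)
  have ndH: "nodes_divide ?t M e" if e: "e \<in> edges H" for e
    unfolding M_def
    by (rule node_product_divisible)
      (use inj inj\<sigma>[OF e] F_sub(1)[OF \<sigma>e[OF e]] finite_subset[OF H_sub(1)[OF e] fV] in auto)
  obtain U and N :: int and K where U: "U \<subseteq> verts H" "card U = ?s" and N: "N > 0"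
    and K: "\<forall>u\<in>U. \<forall>w\<in>U.
       (\<Sum>e\<in>edges H. K u e * scaled_dd ?t M (unit_vec w) e) = (if u = w then N * M else 0)"
    by (rule integral_left_inverse[where H = H and M = M and \<theta> = \<theta> and \<sigma> = \<sigma>, OF fV fE ndH])
      (assumption | rule that)+
  have f: "f \<ge> 1"
  proof -
    obtain e where e: "e \<in> edges F" using ne by blast
    hence "e \<noteq> {}" using F_sub(2)[OF e] r by auto
    thus ?thesis using F_sub(1)[OF e] by (cases f) auto
  qed
  define q where "q = real f ^ (r - 1)"
  have q: "q \<ge> 1" using f by (simp add: q_def)
  define c1 where "c1 = c * (1 / q) powr C * real f ^ ?h / 2"
  have c1: "c1 > 0" using c q f by (simp add: c1_def)
  \<comment> \<open>All integers that are inverted modulo \<open>n\<close> divide \<open>N * M\<close>.\<close>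
  define W where "W = nat \<bar>N * M\<bar>"
  have W: "W > 0" using N M0 by (simp add: W_def)
  have cop: "coprime (N * M) (int n)" if "coprime W n" for n
  proof -
    have "coprime (int W) (int n)" using that by simp
    thus ?thesis by (simp add: W_def)
  qed
  have main: "\<exists>n0. \<forall>n\<ge>n0. coprime W n \<longrightarrow>
    (\<forall>A. A \<subseteq> {0..<int n} \<and> real (card A) \<ge> \<delta> * real n \<longrightarrow>
      real (card {x \<in> ker_mod n k (edges H) (mat_mod B n) \<inter> (edges H \<rightarrow>\<^sub>E A). proper (edges H) x})
        \<ge> c1 * \<delta> powr C * real n ^ ?s)" if \<delta>: "\<delta> > 0" for \<delta>
  proof (cases "\<delta> \<le> 1")
    case False
    \<comment> \<open>No set of residues has density above \<open>1\<close>.\<close>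
    have "\<not> real (card A) \<ge> \<delta> * real n" if "A \<subseteq> {0..<int n}" "n \<ge> 1" for A n
    proof -
      have "card A \<le> n" using card_mono[OF _ that(1)] by simp
      moreover have "real n < \<delta> * real n" using False that(2) by simp
      ultimately show ?thesis by linarith
    qed
    thus ?thesis by blast
  next
    case True
    define \<epsilon> where "\<epsilon> = \<delta> * (1 / q)"
    have \<epsilon>: "0 < \<epsilon>" "\<epsilon> \<le> 1" using \<delta> True q by (auto simp: \<epsilon>_def divide_le_eq)
    have \<epsilon>_powr: "\<epsilon> powr C = \<delta> powr C * (1 / q) powr C"
      unfolding \<epsilon>_def by (rule powr_mult)
    from count \<epsilon> obtain n0 where n0: "\<And>(G :: nat hgraph) \<kappa>. r_graph r G \<Longrightarrow> homomorphism \<kappa> G F \<Longrightarrow>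
        uniformly_far r F \<epsilon> G \<kappa> \<Longrightarrow> card (verts G) \<ge> n0 \<Longrightarrow>
        real (Emb H \<sigma> G \<kappa>) \<ge> c * \<epsilon> powr C * real (card (verts G)) ^ ?h"
      by meson
    define n1 where "n1 = Suc (max n0 (nat \<lceil>real ?m ^ 2 / (c1 * \<delta> powr C)\<rceil>))"
    show ?thesis
    proof (intro exI[of _ n1] allI impI, elim conjE)
      fix n A assume n1: "n1 \<le> n" and Wn: "coprime W n" and A: "A \<subseteq> {0..<int n}"
        and dens: "\<delta> * real n \<le> real (card A)"
      let ?G = "residue_graph r n F \<theta> M A"
      let ?X = "{x \<in> ker_mod n k (edges H) (mat_mod B n) \<inter> (edges H \<rightarrow>\<^sub>E A). proper (edges H) x}"
      have n: "n > 0" and nn0: "n \<ge> n0" using n1 by (auto simp: n1_def)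
      have nm: "real ?m ^ 2 / (c1 * \<delta> powr C) \<le> real n" using n1 by (simp add: n1_def) linarith
      have copM: "coprime M (int n)" using cop[OF Wn] by simp
      have cardG: "card (verts ?G) = f * n" by (simp add: card_verts_residue_graph[OF n] VF)
      have "uniformly_far r F \<epsilon> ?G (\<lambda>v. v div n)"
      proof (rule residue_graph_uniformly_far[OF n r F ne ndF copM A])
        have r1: "r - 1 = Suc (r - 2)" using r by simp
        have "\<epsilon> * real (card (verts F) * n) ^ (r - 1) = \<delta> * real n ^ (r - 1)"
          using f by (simp add: \<epsilon>_def q_def VF power_mult_distrib)
        also have "\<dots> = (\<delta> * real n) * real n ^ (r - 2)" unfolding r1 by simp
        also have "\<dots> \<le> real (card A) * real n ^ (r - 2)" by (intro mult_right_mono dens) simp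
        finally show "\<epsilon> * real (card (verts F) * n) ^ (r - 1) \<le> real (card A * n ^ (r - 2))"
          by simp
      qed
      moreover have "n0 \<le> card (verts ?G)" using nn0 f by (simp add: cardG le_trans)
      ultimately have "c * \<epsilon> powr C * real (card (verts ?G)) ^ ?h \<le> real (Emb H \<sigma> ?G (\<lambda>v. v div n))"
        by (intro n0 r_graph_residue_graph[OF F n] homomorphism_residue_graph[OF n])
      also have "\<dots> \<le> real (card (good_labellings n H ?t M A))"
        using Emb_le_good_labellings[OF n H inj\<sigma>] by simp
      also have "\<dots> \<le> real (card (proper_labellings n H ?t M A) + ?m ^ 2 * n ^ (?h - 1))"
        using good_le_proper_labellings[OF H ndH copM] by (simp only: of_nat_le_iff)
      also have "c * \<epsilon> powr C * real (card (verts ?G)) ^ ?h = 2 * (c1 * \<delta> powr C * real n ^ ?h)"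
        unfolding \<epsilon>_powr by (simp add: cardG c1_def power_mult_distrib)
      finally have low: "2 * (c1 * \<delta> powr C * real n ^ ?h)
        \<le> real (card (proper_labellings n H ?t M A)) + real ?m ^ 2 * real n ^ (?h - 1)" by simp
      have "real ?m ^ 2 * real n ^ (?h - 1) \<le> c1 * \<delta> powr C * real n ^ ?h"
      proof (cases "edges H = {}")
        case False
        then obtain e where e: "e \<in> edges H" by blast
        have "e \<noteq> {}" using H_sub(2)[OF e] r by auto
        hence "?h \<noteq> 0" using H_sub(1)[OF e] fV by auto
        hence "real n ^ ?h = real n * real n ^ (?h - 1)" by (metis power_eq_if)
        moreover have "real ?m ^ 2 \<le> c1 * \<delta> powr C * real n"
          using nm c1 \<delta> by (simp add: divide_le_eq mult_ac)
        ultimately show ?thesis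
          using mult_right_mono[of "real ?m ^ 2" "c1 * \<delta> powr C * real n" "real n ^ (?h - 1)"]
          by (simp add: mult_ac)
      qed (use c1 in simp)
      hence "c1 * \<delta> powr C * real n ^ ?h \<le> real (card (proper_labellings n H ?t M A))"
        using low by linarith
      also have "\<dots> \<le> real (card ?X * n ^ (?h - card U))"
      proof (unfold of_nat_le_iff, rule labellings_le_solutions[OF n H U(1) cop[OF Wn] K[rule_format] _ A])
        show "(\<Sum>e\<in>edges H. B j e * scaled_dd ?t M y e) = 0" if "j < k" for j y
          by (rule ker_rat_annihilates_sdd[OF H ker that ndH])
      qed
      also have "\<dots> = real (card ?X) * real n ^ (?h - ?s)" by (simp add: U(2))
      finally have le: "c1 * \<delta> powr C * real n ^ ?h \<le> real (card ?X) * real n ^ (?h - ?s)" .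
      have "?s \<le> ?h" using card_mono[OF fV U(1)] U(2) by simp
      hence "real n ^ ?h = real n ^ ?s * real n ^ (?h - ?s)" by (simp flip: power_add)
      hence "(c1 * \<delta> powr C * real n ^ ?s) * real n ^ (?h - ?s)
          \<le> real (card ?X) * real n ^ (?h - ?s)" using le by (simp add: mult_ac)
      thus "c1 * \<delta> powr C * real n ^ ?s \<le> real (card ?X)" using n by simp
    qed
  qed
  show ?thesis using W c1 main by blast
qed

text \<open>Entries of size at most \<open>N\<close> are too small to produce a nonzero multiple of \<open>n\<close>.\<close>

lemma modular_solutions_are_integral:
  fixes B :: "nat \<Rightarrow> 'i \<Rightarrow> int"
  assumes I: "finite I" and b: "\<And>j. j < k \<Longrightarrow> (\<Sum>i\<in>I. \<bar>B j i\<bar>) \<le> int b"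
    and A: "A \<subseteq> {1..int N}" and n: "b * N < n"
  shows "ker_mod n k I (mat_mod B n) \<inter> (I \<rightarrow>\<^sub>E A) \<subseteq> int_solutions k I B A"
proof
  fix x assume x: "x \<in> ker_mod n k I (mat_mod B n) \<inter> (I \<rightarrow>\<^sub>E A)"
  have "mat_vec I B x j = 0" if j: "j < k" for j
  proof -
    have xN: "\<bar>x i\<bar> \<le> int N" if i: "i \<in> I" for i
    proof -
      have "x i \<in> A" using x i by blast
      thus ?thesis using A by fastforce
    qed
    have "[mat_vec I B x j = mat_vec I (mat_mod B n) x j] (mod int n)"
      unfolding mat_vec_def mat_mod_def
      by (intro cong_sum cong_mult) (simp_all add: cong_def)
    also have "[mat_vec I (mat_mod B n) x j = 0] (mod int n)"
      using x j by (simp add: ker_mod_def)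
    finally have dvd: "int n dvd mat_vec I B x j" by (simp add: cong_0_iff)
    have "\<bar>mat_vec I B x j\<bar> \<le> (\<Sum>i\<in>I. \<bar>B j i * x i\<bar>)"
      unfolding mat_vec_def by (rule sum_abs)
    also have "\<dots> \<le> (\<Sum>i\<in>I. \<bar>B j i\<bar> * int N)"
      by (intro sum_mono) (use xN in \<open>simp add: abs_mult mult_left_mono\<close>)
    also have "\<dots> = (\<Sum>i\<in>I. \<bar>B j i\<bar>) * int N" by (simp add: sum_distrib_right)
    also have "\<dots> \<le> int b * int N" by (intro mult_right_mono b[OF j]) simp
    also have "\<dots> < int n" using n by (simp flip: of_nat_mult)
    finally have "\<bar>mat_vec I B x j\<bar> < int n" .
    thus ?thesis using dvd_imp_le_int[OF _ dvd] by fastforce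
  qed
  thus "x \<in> int_solutions k I B A" using x by (simp add: int_solutions_def)
qed

lemma row_sums_bounded:
  fixes B :: "nat \<Rightarrow> 'i \<Rightarrow> int"
  obtains b :: nat where "b > 0" "\<And>j. j < k \<Longrightarrow> (\<Sum>i\<in>I. \<bar>B j i\<bar>) \<le> int b"
proof -
  define g where "g j = nat (\<Sum>i\<in>I. \<bar>B j i\<bar>)" for j
  have "(\<Sum>i\<in>I. \<bar>B j i\<bar>) \<le> int (Suc (\<Sum>j<k. g j))" if "j < k" for j
  proof -
    have "g j \<le> (\<Sum>j<k. g j)" using that by (intro member_le_sum) auto
    hence "int (g j) \<le> int (Suc (\<Sum>j<k. g j))" by (simp only: of_nat_le_iff le_SucI)
    moreover have "(\<Sum>i\<in>I. \<bar>B j i\<bar>) = int (g j)" by (simp add: g_def sum_nonneg)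
    ultimately show ?thesis by simp
  qed
  thus thesis by (rule that[OF zero_less_Suc])
qed

theorem theorem4p1:
  fixes r f h m s :: nat
    and F :: "nat hgraph" and H :: "'h hgraph" and \<sigma> :: "'h \<Rightarrow> nat"
    and \<theta> :: "nat \<Rightarrow> int" and S :: "('h set \<Rightarrow> rat) set"
    and B :: "nat \<Rightarrow> 'h set \<Rightarrow> int" and c C :: real
  assumes "r \<ge> 2"
    and "r_graph r F" and "verts F = {1..f}" and "edges F \<noteq> {}" and "no_isolated_vertices F"
    and "r_graph r H" and "no_isolated_vertices H" and "homomorphism \<sigma> H F"
    and "h = card (verts H)" and "m = card (edges H)"
    and "inj_on \<theta> {1..f}"
    and "S = Dimage H \<sigma> \<theta>" and "s = ratfun.dim S"
    and "full_row_rank (m - s) (edges H) B"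
    and "ker_rat (m - s) (edges H) B = S"
    and "c > 0" and "C > 0"
    and "\<forall>\<epsilon>::real. 0 < \<epsilon> \<and> \<epsilon> \<le> 1 \<longrightarrow>
      (\<exists>n0::nat. \<forall>(G :: nat hgraph) \<kappa>.
         r_graph r G \<and> homomorphism \<kappa> G F \<and> uniformly_far r F \<epsilon> G \<kappa> \<and> card (verts G) \<ge> n0 \<longrightarrow>
         real (Emb H \<sigma> G \<kappa>) \<ge> c * \<epsilon> powr C * real (card (verts G)) ^ h)"
  shows
    "(\<exists>c0::real. c0 > 0 \<and> (\<forall>\<delta>::real. \<delta> > 0 \<longrightarrow>
        (\<exists>p0::nat. \<forall>p::nat. prime p \<and> p \<ge> p0 \<longrightarrow>
          (\<forall>A. A \<subseteq> {0..<int p} \<and> real (card A) \<ge> \<delta> * real p \<longrightarrow>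
            real (card (ker_mod p (m - s) (edges H) (mat_mod B p) \<inter> (edges H \<rightarrow>\<^sub>E A)))
              \<ge> c0 * \<delta> powr C * real p ^ s)) \<and>
        (\<exists>N0::nat. \<forall>N::nat. N \<ge> N0 \<longrightarrow>
          (\<forall>A. A \<subseteq> {1..int N} \<and> real (card A) \<ge> \<delta> * real N \<longrightarrow>
            real (card (int_solutions (m - s) (edges H) B A))
              \<ge> c0 * \<delta> powr C * real N ^ s)) \<and>
        (m \<ge> 2 \<longrightarrow>
          (\<exists>p0::nat. \<forall>p::nat. prime p \<and> p \<ge> p0 \<longrightarrow>
            (\<forall>A. A \<subseteq> {0..<int p} \<and> real (card A) \<ge> \<delta> * real p \<longrightarrow>
              real (card {x \<in> ker_mod p (m - s) (edges H) (mat_mod B p) \<inter> (edges H \<rightarrow>\<^sub>E A).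
                            proper (edges H) x})
                \<ge> c0 * \<delta> powr C * real p ^ s)) \<and>
          (\<exists>N0::nat. \<forall>N::nat. N \<ge> N0 \<longrightarrow>
            (\<forall>A. A \<subseteq> {1..int N} \<and> real (card A) \<ge> \<delta> * real N \<longrightarrow>
              real (card {x \<in> int_solutions (m - s) (edges H) B A. proper (edges H) x})
                \<ge> c0 * \<delta> powr C * real N ^ s))))) \<and>
     (\<forall>j < m - s. mat_vec (edges H) B (\<lambda>_. 1) j = 0)"
proof -
  let ?E = "edges H" and ?k = "m - s"
  let ?P = "\<lambda>n A. {x \<in> ker_mod n ?k ?E (mat_mod B n) \<inter> (?E \<rightarrow>\<^sub>E A). proper ?E x}"
  let ?Z = "\<lambda>A. {x \<in> int_solutions ?k ?E B A. proper ?E x}"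
  note H = assms(6) and hom = assms(8)
  have ker: "ker_rat ?k ?E B = Dimage H \<sigma> \<theta>" and s: "s = ratfun.dim (Dimage H \<sigma> \<theta>)"
    using assms by simp_all
  have fV: "finite (verts H)" using H by (simp add: r_graph_def)
  have "?E \<subseteq> Pow (verts H)" using H by (auto simp: r_graph_def)
  hence fE: "finite ?E" using fV by (simp add: finite_subset)
  have inj: "inj_on (\<lambda>v. \<theta> (\<sigma> v)) e" if e: "e \<in> ?E" for e
  proof -
    have \<sigma>e: "\<sigma> ` e \<in> edges F" using hom e by (simp add: homomorphism_def)
    hence "card (\<sigma> ` e) = card e" using assms(2) H e by (simp add: r_graph_def)
    moreover have "finite e" using H e by (auto simp: r_graph_def intro: finite_subset)
    ultimately have "inj_on \<sigma> e" by (simp add: eq_card_imp_inj_on)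
    moreover have "\<sigma> ` e \<subseteq> {1..f}" using assms(2,3) \<sigma>e by (auto simp: r_graph_def)
    ultimately show ?thesis
      using comp_inj_on[of \<sigma> e \<theta>] inj_on_subset[OF assms(11)] by (simp add: comp_def)
  qed
  have rows: "\<forall>j < ?k. mat_vec ?E B (\<lambda>_. 1) j = 0"
    using ker_rat_row_sums_zero[OF H _ ker _ inj] assms(1) by simp
  obtain W c1 where W: "W > 0" and c1: "c1 > 0"
    and core: "\<And>\<delta>. \<delta> > 0 \<Longrightarrow> \<exists>n0. \<forall>n\<ge>n0. coprime W n \<longrightarrow>
      (\<forall>A. A \<subseteq> {0..<int n} \<and> real (card A) \<ge> \<delta> * real n \<longrightarrow>
        real (card (?P n A)) \<ge> c1 * \<delta> powr C * real n ^ s)"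
    using proper_solutions_modulo[OF assms(1-4) H hom assms(11) ker assms(16)
        assms(18)[unfolded assms(9)]] unfolding s by blast
  obtain b where b: "b > 0" "\<And>j. j < ?k \<Longrightarrow> (\<Sum>e\<in>?E. \<bar>B j e\<bar>) \<le> int b"
    by (rule row_sums_bounded[where k = ?k and I = ?E and B = B]) blast
  \<comment> \<open>The loss in density on passing from \<open>{1..N}\<close> to the residues modulo \<open>W * b * N + 1\<close>.\<close>
  define L where "L = 2 * W * b"
  have L: "L \<ge> 1" using W b(1) by (simp add: L_def)
  define c0 where "c0 = c1 * (1 / real L) powr C"
  have c0: "c0 > 0" using c1 L by (simp add: c0_def)
  have c0_le: "c0 \<le> c1"
  proof -
    have "(1 / real L) powr C \<le> 1 powr C" using L assms(17) by (intro powr_mono2) auto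
    thus ?thesis using c1 by (simp add: c0_def mult_left_le)
  qed
  have modular: "\<exists>p0. \<forall>p. prime p \<and> p \<ge> p0 \<longrightarrow>
      (\<forall>A. A \<subseteq> {0..<int p} \<and> real (card A) \<ge> \<delta> * real p \<longrightarrow>
        real (card (?P p A)) \<ge> c0 * \<delta> powr C * real p ^ s)" if \<delta>: "\<delta> > 0" for \<delta> :: real
  proof -
    obtain n0 where n0: "\<And>n A. n \<ge> n0 \<Longrightarrow> coprime W n \<Longrightarrow> A \<subseteq> {0..<int n} \<Longrightarrow>
        real (card A) \<ge> \<delta> * real n \<Longrightarrow> real (card (?P n A)) \<ge> c1 * \<delta> powr C * real n ^ s"
      using core[OF \<delta>] by meson
    show ?thesis
    proof (intro exI[of _ "max n0 (Suc W)"] allI impI, elim conjE)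
      fix p A assume p: "prime p" "max n0 (Suc W) \<le> p" and A: "A \<subseteq> {0..<int p}"
        "\<delta> * real p \<le> real (card A)"
      have "\<not> p dvd W" using p(2) W by (auto dest: dvd_imp_le)
      hence "coprime W p" using prime_imp_coprime[OF p(1)] by (simp add: coprime_commute)
      hence "c1 * \<delta> powr C * real p ^ s \<le> real (card (?P p A))"
        using n0[of p A] p(2) A by simp
      moreover have "c0 * \<delta> powr C * real p ^ s \<le> c1 * \<delta> powr C * real p ^ s"
        by (intro mult_right_mono c0_le) auto
      ultimately show "c0 * \<delta> powr C * real p ^ s \<le> real (card (?P p A))" by linarith
    qed
  qed
  have integral: "\<exists>N0. \<forall>N\<ge>N0. \<forall>A. A \<subseteq> {1..int N} \<and> real (card A) \<ge> \<delta> * real N \<longrightarrow>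
        real (card (?Z A)) \<ge> c0 * \<delta> powr C * real N ^ s" if \<delta>: "\<delta> > 0" for \<delta> :: real
  proof -
    have \<delta>L: "\<delta> / real L > 0" using \<delta> L by simp
    obtain n0 where n0: "\<And>n A. n \<ge> n0 \<Longrightarrow> coprime W n \<Longrightarrow> A \<subseteq> {0..<int n} \<Longrightarrow>
        real (card A) \<ge> \<delta> / real L * real n \<Longrightarrow>
        real (card (?P n A)) \<ge> c1 * (\<delta> / real L) powr C * real n ^ s"
      using core[OF \<delta>L] by meson
    show ?thesis
    proof (intro exI[of _ "Suc n0"] allI impI, elim conjE)
      fix N A assume N: "Suc n0 \<le> N" and A: "A \<subseteq> {1..int N}" and dens: "\<delta> * real N \<le> real (card A)"
      \<comment> \<open>Coprime to \<open>W\<close>, large enough to prevent wrap-around, and only a constant factor above \<open>N\<close>.\<close>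
      define n where "n = W * b * N + 1"
      have bN: "b * N < n" using W by (simp add: n_def mult.assoc less_Suc_eq_le)
      moreover have "N \<le> b * N" using b(1) by simp
      ultimately have Nn: "N < n" by linarith
      have "coprime W n"
      proof (rule coprimeI)
        fix d assume d: "d dvd W" "d dvd n"
        hence "d dvd W * b * N" by (simp add: mult.assoc)
        thus "d dvd 1" using d(2) unfolding n_def by (simp only: dvd_add_right_iff)
      qed
      have nL: "n \<le> L * N" using N W b(1) by (simp add: n_def L_def)
      have "\<delta> / real L * real n \<le> \<delta> / real L * real (L * N)"
        by (intro mult_left_mono) (use nL \<delta>L in \<open>simp_all only: of_nat_le_iff less_imp_le\<close>)
      also have "\<dots> = \<delta> * real N" using L by simp
      finally have dens': "real (card A) \<ge> \<delta> / real L * real n" using dens by linarith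
      have "c0 * \<delta> powr C * real N ^ s = c1 * (\<delta> / real L) powr C * real N ^ s"
        using \<delta> powr_mult[of \<delta> "1 / real L" C] by (simp add: c0_def mult_ac)
      also have "\<dots> \<le> c1 * (\<delta> / real L) powr C * real n ^ s"
        using Nn c1 by (intro mult_left_mono power_mono) auto
      also have "\<dots> \<le> real (card (?P n A))"
        using n0[OF _ \<open>coprime W n\<close> _ dens'] N Nn A by fastforce
      also have "\<dots> \<le> real (card (?Z A))"
      proof (unfold of_nat_le_iff, rule card_mono)
        have "finite A" using A by (rule finite_subset) simp
        hence "finite (?E \<rightarrow>\<^sub>E A)" using fE by (intro finite_PiE) auto
        thus "finite (?Z A)" by (rule rev_finite_subset) (auto simp: int_solutions_def)
        show "?P n A \<subseteq> ?Z A"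
          using modular_solutions_are_integral[where k = ?k and B = B, OF fE b(2) A bN] by blast
      qed
      finally show "c0 * \<delta> powr C * real N ^ s \<le> real (card (?Z A))" .
    qed
  qed
  have weak_modular: "\<exists>p0. \<forall>p. prime p \<and> p \<ge> p0 \<longrightarrow>
      (\<forall>A. A \<subseteq> {0..<int p} \<and> real (card A) \<ge> \<delta> * real p \<longrightarrow>
        real (card (ker_mod p ?k ?E (mat_mod B p) \<inter> (?E \<rightarrow>\<^sub>E A))) \<ge> c0 * \<delta> powr C * real p ^ s)"
    if \<delta>: "\<delta> > 0" for \<delta> :: real
  proof -
    have "real (card (?P p A)) \<le> real (card (ker_mod p ?k ?E (mat_mod B p) \<inter> (?E \<rightarrow>\<^sub>E A)))"
      if "A \<subseteq> {0..<int p}" for p A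
    proof (unfold of_nat_le_iff, rule card_mono)
      show "finite (ker_mod p ?k ?E (mat_mod B p) \<inter> (?E \<rightarrow>\<^sub>E A))"
        using finite_subset[OF that] fE by (intro finite_Int disjI2 finite_PiE) auto
    qed auto
    thus ?thesis using modular[OF \<delta>] by (meson order_trans)
  qed
  have weak_integral: "\<exists>N0. \<forall>N\<ge>N0. \<forall>A. A \<subseteq> {1..int N} \<and> real (card A) \<ge> \<delta> * real N \<longrightarrow>
        real (card (int_solutions ?k ?E B A)) \<ge> c0 * \<delta> powr C * real N ^ s"
    if \<delta>: "\<delta> > 0" for \<delta> :: real
  proof -
    have "real (card (?Z A)) \<le> real (card (int_solutions ?k ?E B A))"
      if "A \<subseteq> {1..int N}" for N A
    proof (unfold of_nat_le_iff, rule card_mono)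
      have "finite (?E \<rightarrow>\<^sub>E A)" using finite_subset[OF that] fE by (intro finite_PiE) auto
      thus "finite (int_solutions ?k ?E B A)"
        by (rule rev_finite_subset) (auto simp: int_solutions_def)
    qed auto
    thus ?thesis using integral[OF \<delta>] by (meson order_trans)
  qed
  show ?thesis
    by (intro conjI exI[of _ c0] c0 allI impI weak_modular weak_integral modular integral
        rows[rule_format])
qed

end
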